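(* Let $\mathcal{P}=\mathcal{P}_{11/20}$ and let $$\Lambda=\{(\alpha,\theta,\phi,\theta',\phi') : \alpha\in[0,2\pi],\ \phi'\in[0,2\pi],\ \phi\in[0,\pi],\ \theta\in[0,\pi/2],\ \theta'\in[0,\pi/2]\}\subset\mathbb{R}^5,$$ equipped with $5$-dimensional Lebesgue measure $\lambda$. There is a measurable set $E\subseteq\Lambda$ with $\lambda(E)\ge 0.88\,\lambda(\Lambda)$ such that no point $(\alpha,\theta,\phi,\theta',\phi')\in E$ is a Rupert passage for $\mathcal{P}_{11/20}$.
   Context: For $a\in\mathbb{R}$, $\mathcal{P}_a\subset\mathbb{R}^3$ is the convex hull of the eight points $p_0=(1,1,1)$, $p_1=(1,-1,-1)$, $p_2=(-1,1,-1)$, $p_3=(-1,-1,1)$, $q_0=(-a,-a,-a)$, $q_1=(-a,a,a)$, $q_2=(a,-a,a)$, $q_3=(a,a,-a)$. For angles $\theta,\phi$, let $M_{\theta,\phi}:\mathbb{R}^3\to\mathbb{R}^2$ be the linear map with matrix $$M_{\theta,\phi}=\begin{pmatrix}-\sin\theta & \cos\theta & 0\\ -\cos\theta\cos\phi & -\sin\theta\cos\phi & \sin\phi\end{pmatrix},$$ and let $R_\alpha$ be counterclockwise rotation of $\mathbb{R}^2$ by angle $\alpha$. For convex polygons $P,Q\subset\mathbb{R}^2$ (convex hulls of finitely many points), say that $P$ fits inside $Q$ if there exist $s>1$ and $t\in\mathbb{R}^2$ with $sP+t\subseteq Q^\circ$, where $Q^\circ$ is the interior of $Q$. A tuple $(\alpha,\theta,\phi,\theta',\phi')$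 is a Rupert passage for a polyhedron $\mathcal{P}$ if $R_\alpha M_{\theta,\phi}\mathcal{P}$ fits inside $M_{\theta',\phi'}\mathcal{P}$. *)

theory Defs
  imports "HOL-Analysis.Analysis"
begin

definition pt3 :: "real \<Rightarrow> real \<Rightarrow> real \<Rightarrow> real^3" where
  "pt3 x y z = vector [x, y, z]"

definition pt2 :: "real \<Rightarrow> real \<Rightarrow> real^2" where
  "pt2 x y = vector [x, y]"

definition polyP :: "real \<Rightarrow> (real^3) set" where
  "polyP a = convex hull
     {pt3 1 1 1, pt3 1 (-1) (-1), pt3 (-1) 1 (-1), pt3 (-1) (-1) 1,
      pt3 (-a) (-a) (-a), pt3 (-a) a a, pt3 a (-a) a, pt3 a a (-a)}"

definition projM :: "real \<Rightarrow> real \<Rightarrow> real^3 \<Rightarrow> real^2" where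
  "projM \<theta> \<phi> x =
     pt2 (- sin \<theta> * x$1 + cos \<theta> * x$2)
         (- cos \<theta> * cos \<phi> * x$1 - sin \<theta> * cos \<phi> * x$2 + sin \<phi> * x$3)"

definition rot :: "real \<Rightarrow> real^2 \<Rightarrow> real^2" where
  "rot \<alpha> v = pt2 (cos \<alpha> * v$1 - sin \<alpha> * v$2) (sin \<alpha> * v$1 + cos \<alpha> * v$2)"

definition fits_inside :: "(real^2) set \<Rightarrow> (real^2) set \<Rightarrow> bool" where
  "fits_inside P Q \<longleftrightarrow> (\<exists>s>1. \<exists>t. (\<lambda>x. s *\<^sub>R x + t) ` P \<subseteq> interior Q)"

definition rupert_passage ::
  "(real^3) set \<Rightarrow> real \<Rightarrow> real \<Rightarrow> real \<Rightarrow> real \<Rightarrow> real \<Rightarrow> bool" where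
  "rupert_passage K \<alpha> \<theta> \<phi> \<theta>' \<phi>' \<longleftrightarrow>
     fits_inside (rot \<alpha> ` projM \<theta> \<phi> ` K) (projM \<theta>' \<phi>' ` K)"

text \<open>Parameter box Lambda, coordinates ordered (alpha, theta, phi, theta', phi').\<close>
definition Lambda :: "(real \<times> real \<times> real \<times> real \<times> real) set" where
  "Lambda = {0..2*pi} \<times> {0..pi/2} \<times> {0..pi} \<times> {0..pi/2} \<times> {0..2*pi}"

end

theory Submission
  imports Defs
begin

text \<open>
  If one shadow fits inside another, then each of its widths is smaller than the parallel width of
  the other. The width of the polyhedron in a direction \<open>n\<close> is the largest of the numbers
  \<open>2 * (\<bar>n\<^sub>i\<bar> + \<bar>n\<^sub>j\<bar>)\<close> and \<open>31/20 * (\<bar>n\<^sub>1\<bar> + \<bar>n\<^sub>2\<bar> + \<bar>n\<^sub>3\<bar>)\<close>; among unit vectors it is small only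
  near the six coordinate half-axes. Let \<open>v\<close> be the view direction of the second pose and suppose
  \<open>\<bar>v\<^sub>3\<bar> = q * (\<bar>v\<^sub>1\<bar> + \<bar>v\<^sub>2\<bar>)\<close> with \<open>q\<close> minimal under permutations of the axes. The plane
  orthogonal to \<open>v\<close> contains a vector proportional to \<open>(\<plusminus>q, \<plusminus>q, 1)\<close>, and its width is so small that a
  passage forces the corresponding vector of the first pose close to an axis: the ratio of its
  second largest to its largest coordinate must be less than \<open>q\<close> (less than \<open>tan 30\<degree>\<close> if \<open>q\<close> is close to its maximum \<open>1/2\<close>).
  As \<open>\<alpha>\<close> varies, that vector sweeps a great circle uniformly, so this is a rare event
  whose probability depends on the second pose through \<open>q\<close> only. Rounding \<open>q\<close> up to the tangent of
  4, 8, 11, 14, 18, 22 or 30 degrees and covering the plane regions involved by columns of one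
  degree bounds the exceptional set by 0.1186 of the volume of \<open>\<Lambda>\<close>.
\<close>

section \<open>Widths of the polyhedron\<close>

text \<open>The threshold for the first pose can equal \<open>q\<close> because the probe (q, q, 1)
  has the very shape that minimises the width among unit vectors whose second largest coordinate is
  at least \<open>q\<close> times the largest: both give 2 (1 + q) / sqrt (1 + 2 q^2). This match
  lasts as long as 2 (a + b) is the active width on (1 : q : q), that is up to q = 9/22, between the
  tangents of 22 and 23 degrees. Beyond that, vectors on which two width formulas agree are narrower
  than (1 : q : q). All remaining poses are therefore compared with the worst probe (1 : 1 : 2), of
  squared width 961/150 per squared length, and 30 degrees is the first whole degree for which that
  comparison succeeds. The volume on \<open>Lambda\<close> weights \<phi> uniformly and not by sin
  \<phi>, so the direction vector is not equidistributed on the sphere and the three axes are not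
  interchangeable. Changing \<theta> rotates about the third axis; nearness to that axis is a
  condition on (\<alpha>, \<phi>) alone, nearness to the other two mainly one on \<theta>. This
  asymmetry forces the integration over \<phi> column by column.\<close>

text \<open>The first three terms come from the differences of two points p_i, which are the vectors
  with two entries 2 or -2 and one entry 0. The last comes from p_i - q_i, whose entries are all
  31/20 up to sign. Both families contain every sign pattern, hence the absolute values.\<close>

definition width_norm :: "real \<Rightarrow> real \<Rightarrow> real \<Rightarrow> real" where
  "width_norm a b c = max (max (2 * (\<bar>a\<bar> + \<bar>b\<bar>)) (2 * (\<bar>a\<bar> + \<bar>c\<bar>)))
     (max (2 * (\<bar>b\<bar> + \<bar>c\<bar>)) (31/20 * (\<bar>a\<bar> + \<bar>b\<bar> + \<bar>c\<bar>)))"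

lemma pt_nth [simp]: "pt3 x y z $ 1 = x" "pt3 x y z $ 2 = y" "pt3 x y z $ 3 = z"
    "pt2 x y $ 1 = x" "pt2 x y $ 2 = y"
  by (simp_all add: pt3_def pt2_def)

lemma width_norm_ge:
  "2 * (\<bar>a\<bar> + \<bar>b\<bar>) \<le> width_norm a b c" "2 * (\<bar>a\<bar> + \<bar>c\<bar>) \<le> width_norm a b c"
  "2 * (\<bar>b\<bar> + \<bar>c\<bar>) \<le> width_norm a b c" "31/20 * (\<bar>a\<bar> + \<bar>b\<bar> + \<bar>c\<bar>) \<le> width_norm a b c"
  unfolding width_norm_def by (meson max.cobounded1 max.cobounded2 order_trans)+

lemma width_norm_le:
  assumes "2 * (\<bar>a\<bar> + \<bar>b\<bar>) \<le> m" "2 * (\<bar>a\<bar> + \<bar>c\<bar>) \<le> m"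
    "2 * (\<bar>b\<bar> + \<bar>c\<bar>) \<le> m" "31/20 * (\<bar>a\<bar> + \<bar>b\<bar> + \<bar>c\<bar>) \<le> m"
  shows "width_norm a b c \<le> m"
  unfolding width_norm_def by (intro max.boundedI assms)

definition poly_verts :: "(real^3) set" where
  "poly_verts = {pt3 1 1 1, pt3 1 (-1) (-1), pt3 (-1) 1 (-1), pt3 (-1) (-1) 1,
      pt3 (-(11/20)) (-(11/20)) (-(11/20)), pt3 (-(11/20)) (11/20) (11/20),
      pt3 (11/20) (-(11/20)) (11/20), pt3 (11/20) (11/20) (-(11/20))}"

lemma polyP_eq_hull: "polyP (11/20) = convex hull poly_verts"
  by (simp add: polyP_def poly_verts_def)

text \<open>The upper half of the width formula, applied to the second pose. The bound is checked on
  the 64 pairs of vertices and carried to the hull by enclosing the vertices in a half-space, once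
  for each of the two points.\<close>

lemma linear_diff_le_width_norm:
  assumes "w \<in> polyP (11/20)" "w' \<in> polyP (11/20)"
  shows "(a * w$1 + b * w$2 + c * w$3) - (a * w'$1 + b * w'$2 + c * w'$3) \<le> width_norm a b c"
proof -
  define f :: "real^3 \<Rightarrow> real" where "f = (\<lambda>w. a * w$1 + b * w$2 + c * w$3)"
  define A B C where "A = \<bar>a\<bar>" and "B = \<bar>b\<bar>" and "C = \<bar>c\<bar>"
  have ABC: "0 \<le> A" "0 \<le> B" "0 \<le> C"
    "2 * (A + B) \<le> width_norm a b c" "2 * (A + C) \<le> width_norm a b c"
    "2 * (B + C) \<le> width_norm a b c" "31/20 * (A + B + C) \<le> width_norm a b c"
    unfolding A_def B_def C_def by (fact abs_ge_zero width_norm_ge)+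
  have diff: "f v - f v' \<le> \<bar>v$1 - v'$1\<bar> * A + \<bar>v$2 - v'$2\<bar> * B + \<bar>v$3 - v'$3\<bar> * C" for v v'
  proof -
    have "f v - f v' = (v$1 - v'$1) * a + (v$2 - v'$2) * b + (v$3 - v'$3) * c"
      by (simp add: f_def algebra_simps)
    also have "\<dots> \<le> \<bar>v$1 - v'$1\<bar> * A + \<bar>v$2 - v'$2\<bar> * B + \<bar>v$3 - v'$3\<bar> * C"
      unfolding A_def B_def C_def abs_mult[symmetric] by (intro add_mono abs_ge_self)
    finally show ?thesis .
  qed
  have le: "\<forall>v\<in>poly_verts. \<forall>v'\<in>poly_verts.
      \<bar>v$1 - v'$1\<bar> * A + \<bar>v$2 - v'$2\<bar> * B + \<bar>v$3 - v'$3\<bar> * C \<le> width_norm a b c"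
    unfolding poly_verts_def ball_simps pt_nth
    by (intro conjI TrueI; use ABC in simp)
  have V: "f v - f v' \<le> width_norm a b c" if "v \<in> poly_verts" "v' \<in> poly_verts" for v v'
    by (rule order_trans[OF diff le[rule_format, OF that]])
  have half: "convex {w. f w \<le> C}" "convex {w. C \<le> f w}" for C
    using convex_halfspace_le[of "vector [a,b,c] :: real^3" C]
      convex_halfspace_ge[of C "vector [a,b,c] :: real^3"]
    by (simp_all add: f_def inner_vec_def sum_3)
  have "f w \<le> f v' + width_norm a b c" if "v' \<in> poly_verts" for v'
  proof -
    have "poly_verts \<subseteq> {w. f w \<le> f v' + width_norm a b c}"
      using V[OF _ that] by (auto simp: diff_le_eq add.commute)
    from hull_minimal[OF this, of convex, OF half(1)] show ?thesis
      using assms(1) unfolding polyP_eq_hull by blast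
  qed
  then have "poly_verts \<subseteq> {w'. f w - width_norm a b c \<le> f w'}"
    by (auto simp: diff_le_eq)
  from hull_minimal[OF this, of convex, OF half(2)] have "f w - width_norm a b c \<le> f w'"
    using assms(2) unfolding polyP_eq_hull by blast
  then show ?thesis by (simp add: f_def)
qed

text \<open>The lower half of the width formula, applied to the first pose. If all vertex pairs
  stayed strictly below the value, so would each of the four terms, since 12 edge vectors and 8
  diagonals realise all sign patterns, and hence so would their maximum.\<close>

lemma width_norm_attained:
  obtains w w' where "w \<in> polyP (11/20)" "w' \<in> polyP (11/20)"
    "width_norm a b c \<le> (a * w$1 + b * w$2 + c * w$3) - (a * w'$1 + b * w'$2 + c * w'$3)"
proof (rule ccontr)
  define M where "M = width_norm a b c"
  note witness = that
  assume neg: "\<not> thesis"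
  have sub: "poly_verts \<subseteq> polyP (11/20)"
    unfolding polyP_eq_hull by (rule hull_subset)
  have "\<forall>w\<in>poly_verts. \<forall>w'\<in>poly_verts.
      (a * w$1 + b * w$2 + c * w$3) - (a * w'$1 + b * w'$2 + c * w'$3) < M"
    using witness[OF subsetD[OF sub] subsetD[OF sub]] neg
    unfolding M_def by (meson linorder_not_le)
  note * = this[rule_format, unfolded poly_verts_def]
  have p1: "2*(b+c) < M" using *[of "pt3 1 1 1" "pt3 1 (-1) (-1)"] by simp
  have p2: "2*(-b-c) < M" using *[of "pt3 1 (-1) (-1)" "pt3 1 1 1"] by simp
  have p3: "2*(a+c) < M" using *[of "pt3 1 1 1" "pt3 (-1) 1 (-1)"] by simp
  have p4: "2*(-a-c) < M" using *[of "pt3 (-1) 1 (-1)" "pt3 1 1 1"] by simp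
  have p5: "2*(a+b) < M" using *[of "pt3 1 1 1" "pt3 (-1) (-1) 1"] by simp
  have p6: "2*(-a-b) < M" using *[of "pt3 (-1) (-1) 1" "pt3 1 1 1"] by simp
  have p7: "2*(a-b) < M" using *[of "pt3 1 (-1) (-1)" "pt3 (-1) 1 (-1)"] by simp
  have p8: "2*(b-a) < M" using *[of "pt3 (-1) 1 (-1)" "pt3 1 (-1) (-1)"] by simp
  have p9: "2*(a-c) < M" using *[of "pt3 1 (-1) (-1)" "pt3 (-1) (-1) 1"] by simp
  have p10: "2*(c-a) < M" using *[of "pt3 (-1) (-1) 1" "pt3 1 (-1) (-1)"] by simp
  have p11: "2*(b-c) < M" using *[of "pt3 (-1) 1 (-1)" "pt3 (-1) (-1) 1"] by simp
  have p12: "2*(c-b) < M" using *[of "pt3 (-1) (-1) 1" "pt3 (-1) 1 (-1)"] by simp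
  have q1: "31/20*(a+b+c) < M" using *[of "pt3 1 1 1" "pt3 (-(11/20)) (-(11/20)) (-(11/20))"] by simp
  have q2: "31/20*(-(a+b+c)) < M" using *[of "pt3 (-(11/20)) (-(11/20)) (-(11/20))" "pt3 1 1 1"] by simp
  have q3: "31/20*(a-b-c) < M" using *[of "pt3 1 (-1) (-1)" "pt3 (-(11/20)) (11/20) (11/20)"] by simp
  have q4: "31/20*(-(a-b-c)) < M" using *[of "pt3 (-(11/20)) (11/20) (11/20)" "pt3 1 (-1) (-1)"] by simp
  have q5: "31/20*(-a+b-c) < M" using *[of "pt3 (-1) 1 (-1)" "pt3 (11/20) (-(11/20)) (11/20)"] by simp
  have q6: "31/20*(-(-a+b-c)) < M" using *[of "pt3 (11/20) (-(11/20)) (11/20)" "pt3 (-1) 1 (-1)"] by simp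
  have q7: "31/20*(-a-b+c) < M" using *[of "pt3 (-1) (-1) 1" "pt3 (11/20) (11/20) (-(11/20))"] by simp
  have q8: "31/20*(-(-a-b+c)) < M" using *[of "pt3 (11/20) (11/20) (-(11/20))" "pt3 (-1) (-1) 1"] by simp
  have "2 * (\<bar>a\<bar> + \<bar>b\<bar>) < M" "2 * (\<bar>a\<bar> + \<bar>c\<bar>) < M" "2 * (\<bar>b\<bar> + \<bar>c\<bar>) < M"
    using p1 p2 p3 p4 p5 p6 p7 p8 p9 p10 p11 p12 by (simp_all add: abs_if)
  moreover have "31/20 * (\<bar>a\<bar> + \<bar>b\<bar> + \<bar>c\<bar>) < M"
    using q1 q2 q3 q4 q5 q6 q7 q8 by (simp add: abs_if)
  ultimately show False
    unfolding M_def width_norm_def by (metis max_less_iff_conj less_irrefl)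
qed

text \<open>The functional \<open>cos t * x\<^sub>1 + sin t * x\<^sub>2\<close> on the plane, pulled back along the projection;
  \<open>i\<close> is 0, 1 or 2.\<close>

definition view_vec :: "real \<Rightarrow> real \<Rightarrow> real \<Rightarrow> nat \<Rightarrow> real" where
  "view_vec \<theta> \<phi> t i =
     (if i = 0 then - sin \<theta> * cos t - cos \<theta> * cos \<phi> * sin t
      else if i = 1 then cos \<theta> * cos t - sin \<theta> * cos \<phi> * sin t
      else sin \<phi> * sin t)"

definition view_width :: "real \<Rightarrow> real \<Rightarrow> real \<Rightarrow> real" where
  "view_width \<theta> \<phi> t = width_norm (view_vec \<theta> \<phi> t 0) (view_vec \<theta> \<phi> t 1) (view_vec \<theta> \<phi> t 2)"

lemma view_vec_norm: "(view_vec \<theta> \<phi> t 0)\<^sup>2 + (view_vec \<theta> \<phi> t 1)\<^sup>2 + (view_vec \<theta> \<phi> t 2)\<^sup>2 = 1"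
proof -
  have "sin \<theta> ^ 2 = 1 - cos \<theta> ^ 2" "sin \<phi> ^ 2 = 1 - cos \<phi> ^ 2" "sin t ^ 2 = 1 - cos t ^ 2"
    by (simp_all add: sin_squared_eq)
  then show ?thesis by (simp add: view_vec_def) algebra
qed

lemma view_width_pos: "view_width \<theta> \<phi> t > 0"
proof (rule ccontr)
  assume "\<not> ?thesis"
  then have "31/20 * (\<bar>view_vec \<theta> \<phi> t 0\<bar> + \<bar>view_vec \<theta> \<phi> t 1\<bar> + \<bar>view_vec \<theta> \<phi> t 2\<bar>) \<le> 0"
    unfolding view_width_def using width_norm_ge(4) by (meson linorder_not_le order_trans)
  then have "view_vec \<theta> \<phi> t 0 = 0" "view_vec \<theta> \<phi> t 1 = 0" "view_vec \<theta> \<phi> t 2 = 0" by auto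
  then show False using view_vec_norm[of \<theta> \<phi> t] by simp
qed

text \<open>Rotating by \<alpha> turns the functional of direction \<open>t\<close> into that of
  direction \<open>t - \<alpha>\<close>. Containment gives s times the first width at most the
  second; s > 1 and positivity of the first width make this strict.\<close>

lemma rupert_passage_view_width:
  assumes "rupert_passage (polyP (11/20)) \<alpha> \<theta> \<phi> \<theta>' \<phi>'"
  shows "view_width \<theta> \<phi> (t - \<alpha>) < view_width \<theta>' \<phi>' t"
proof -
  let ?K = "polyP (11/20)"
  let ?g = "\<lambda>\<theta> \<phi> t w. view_vec \<theta> \<phi> t 0 * w$1 + view_vec \<theta> \<phi> t 1 * w$2 + view_vec \<theta> \<phi> t 2 * (w :: real^3)$3"
  define u where "u = (\<lambda>z :: real^2. cos t * z$1 + sin t * z$2)"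
  obtain s d where "s > 1" and s: "(\<lambda>x. s *\<^sub>R x + d) ` rot \<alpha> ` projM \<theta> \<phi> ` ?K \<subseteq> interior (projM \<theta>' \<phi>' ` ?K)"
    using assms unfolding rupert_passage_def fits_inside_def by blast
  have uX: "u (rot \<alpha> (projM \<theta> \<phi> w)) = ?g \<theta> \<phi> (t - \<alpha>) w" for w
    by (simp add: u_def rot_def projM_def view_vec_def sin_diff cos_diff algebra_simps)
  have uY: "u (projM \<theta>' \<phi>' w) = ?g \<theta>' \<phi>' t w" for w
    by (simp add: u_def projM_def view_vec_def algebra_simps)
  obtain w w' where w: "w \<in> ?K" "w' \<in> ?K"
    "view_width \<theta> \<phi> (t - \<alpha>) \<le> ?g \<theta> \<phi> (t - \<alpha>) w - ?g \<theta> \<phi> (t - \<alpha>) w'"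
    unfolding view_width_def using width_norm_attained by blast
  have "\<exists>z\<in>?K. s *\<^sub>R rot \<alpha> (projM \<theta> \<phi> v) + d = projM \<theta>' \<phi>' z" if "v \<in> ?K" for v
  proof -
    have "s *\<^sub>R rot \<alpha> (projM \<theta> \<phi> v) + d \<in> projM \<theta>' \<phi>' ` ?K"
      using s interior_subset that by blast
    then show ?thesis by blast
  qed
  then obtain z z' where z: "z \<in> ?K" "z' \<in> ?K"
    "s *\<^sub>R rot \<alpha> (projM \<theta> \<phi> w) + d = projM \<theta>' \<phi>' z" "s *\<^sub>R rot \<alpha> (projM \<theta> \<phi> w') + d = projM \<theta>' \<phi>' z'"
    using w by meson
  have lin: "u (s *\<^sub>R x + d) - u (s *\<^sub>R y + d) = s * (u x - u y)" for x y
    by (simp add: u_def algebra_simps)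
  have "view_width \<theta> \<phi> (t - \<alpha>) < s * view_width \<theta> \<phi> (t - \<alpha>)"
    using \<open>s > 1\<close> view_width_pos[of \<theta> \<phi> "t - \<alpha>"] by simp
  also have "\<dots> \<le> s * (u (rot \<alpha> (projM \<theta> \<phi> w)) - u (rot \<alpha> (projM \<theta> \<phi> w')))"
    using w(3) \<open>s > 1\<close> by (simp add: uX)
  also have "\<dots> = u (projM \<theta>' \<phi>' z) - u (projM \<theta>' \<phi>' z')"
    using z(3,4) by (simp flip: lin)
  also have "\<dots> \<le> view_width \<theta>' \<phi>' t"
    unfolding uY view_width_def by (rule linear_diff_le_width_norm[OF z(1,2)])
  finally show ?thesis .
qed

section \<open>Directions of small width\<close>

text \<open>For \<rho> = tan k this is the union of six open square pyramids around the coordinate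
  half-axes, with half-angle k in the two coordinate planes through the axis.\<close>

definition dominated :: "real \<Rightarrow> real \<Rightarrow> real \<Rightarrow> real \<Rightarrow> bool" where
  "dominated \<rho> a b c \<longleftrightarrow> (\<bar>b\<bar> < \<rho> * \<bar>a\<bar> \<and> \<bar>c\<bar> < \<rho> * \<bar>a\<bar>) \<or>
     (\<bar>a\<bar> < \<rho> * \<bar>b\<bar> \<and> \<bar>c\<bar> < \<rho> * \<bar>b\<bar>) \<or> (\<bar>a\<bar> < \<rho> * \<bar>c\<bar> \<and> \<bar>b\<bar> < \<rho> * \<bar>c\<bar>)"

text \<open>The sum of squares is convex, so on the polytope cut out by the hypotheses on \<open>W\<close> it is maximal
  at one of the vertices with \<open>(a : b : c) = (1 : \<rho> : \<rho>)\<close> or \<open>(22 : 9 : 9)\<close> or \<open>(31 : 31 : 18)\<close>. The bound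
  \<open>\<rho> \<le> 9/22\<close> makes the first vertex the worst.\<close>

lemma sorted_width_bound:
  fixes a b c \<rho> W :: real
  assumes ord: "0 \<le> c" "c \<le> b" "b \<le> a" and \<rho>: "0 \<le> \<rho>" "\<rho> \<le> 9/22" "\<rho> * a \<le> b"
    and W: "2 * (a + b) \<le> W" "31/20 * (a + b + c) \<le> W"
  shows "4 * (1 + \<rho>)\<^sup>2 * (a\<^sup>2 + b\<^sup>2 + c\<^sup>2) \<le> W\<^sup>2 * (1 + 2 * \<rho>\<^sup>2)"
proof -
  \<comment> \<open>At (22 : 9 : 9) the squared length is 646 and (a + b)^2 is 961, so this compares
    the vertex (1 : \<rho> : \<rho>) with (22 : 9 : 9). The first factor on the right vanishes at
    \<rho> = 9/22, where the two coincide.\<close>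
  have \<rho>2: "646 * (1 + \<rho>)\<^sup>2 \<le> 961 * (1 + 2 * \<rho>\<^sup>2)"
  proof -
    have "961 * (1 + 2 * \<rho>\<^sup>2) - 646 * (1 + \<rho>)\<^sup>2 = (9 - 22 * \<rho>) * (35 - 58 * \<rho>)"
      by (simp add: power2_eq_square algebra_simps)
    also have "\<dots> \<ge> 0" using \<rho> by (intro mult_nonneg_nonneg) auto
    finally show ?thesis by simp
  qed
  have ab: "961 * (a\<^sup>2 + b\<^sup>2) \<le> 565 * (a + b)\<^sup>2" if "9/22 * a \<le> b"
  proof -
    have "565 * (a + b)\<^sup>2 - 961 * (a\<^sup>2 + b\<^sup>2) = (22 * b - 9 * a) * (44 * a - 18 * b)"
      by (simp add: power2_eq_square algebra_simps)
    also have "\<dots> \<ge> 0" using that ord by (intro mult_nonneg_nonneg) auto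
    finally show ?thesis by simp
  qed
  show ?thesis
  \<comment> \<open>The plane c = 9/31 (a + b) is where 2 (a + b) and 31/20 (a + b + c) agree; below
    it the former is the larger.\<close>
  proof (cases "c \<le> 9/31 * (a + b)")
    case True
    have "(1 + \<rho>)\<^sup>2 * (a\<^sup>2 + b\<^sup>2 + c\<^sup>2) \<le> (a + b)\<^sup>2 * (1 + 2 * \<rho>\<^sup>2)"
    proof (cases "9/22 * a \<le> b")
      case True
      have "c\<^sup>2 \<le> (9/31 * (a + b))\<^sup>2" using \<open>c \<le> 9/31 * (a + b)\<close> ord by (intro power_mono) auto
      also have "\<dots> = 81/961 * (a + b)\<^sup>2" by (simp add: power2_eq_square field_simps)
      finally have "961 * (a\<^sup>2 + b\<^sup>2 + c\<^sup>2) \<le> 646 * (a + b)\<^sup>2"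
        using ab[OF True] by (simp add: distrib_left)
      then have "(1 + \<rho>)\<^sup>2 * (961 * (a\<^sup>2 + b\<^sup>2 + c\<^sup>2)) \<le> (1 + \<rho>)\<^sup>2 * (646 * (a + b)\<^sup>2)"
        by (rule mult_left_mono) simp
      also have "\<dots> = (646 * (1 + \<rho>)\<^sup>2) * (a + b)\<^sup>2" by simp
      also have "\<dots> \<le> (961 * (1 + 2 * \<rho>\<^sup>2)) * (a + b)\<^sup>2"
        by (rule mult_right_mono[OF \<rho>2]) simp
      finally show ?thesis by (simp add: algebra_simps)
    next
      case False
      have "\<rho> * b \<le> 9/22 * a" using \<rho> ord by (intro mult_mono) auto
      moreover have "\<rho> * a \<le> 9/22 * a" using \<rho> ord by (intro mult_right_mono) auto
      moreover have "\<rho> * b \<le> 9/22 * (9/22 * a)" using \<rho> ord False by (intro mult_mono) auto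
      \<comment> \<open>With c raised to b, this factorisation says that (1 + r)^2 / (1 + 2 r^2) at
        r = b/a is at least its value at r = \<rho>.\<close>
      ultimately have "0 \<le> (b - \<rho> * a) * (2 * a - b - \<rho> * a - 4 * (\<rho> * b))"
        using \<rho> False ord by (intro mult_nonneg_nonneg) auto
      also have "\<dots> = (a + b)\<^sup>2 * (1 + 2 * \<rho>\<^sup>2) - (1 + \<rho>)\<^sup>2 * (a\<^sup>2 + b\<^sup>2 + b\<^sup>2)"
        by (simp add: power2_eq_square algebra_simps)
      also have "\<dots> \<le> (a + b)\<^sup>2 * (1 + 2 * \<rho>\<^sup>2) - (1 + \<rho>)\<^sup>2 * (a\<^sup>2 + b\<^sup>2 + c\<^sup>2)"
        using ord by (intro diff_left_mono mult_left_mono add_left_mono power_mono) auto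
      finally show ?thesis by simp
    qed
    moreover have "(2 * (a + b))\<^sup>2 \<le> W\<^sup>2" using W ord by (intro power_mono) auto
    then have "(2 * (a + b))\<^sup>2 * (1 + 2 * \<rho>\<^sup>2) \<le> W\<^sup>2 * (1 + 2 * \<rho>\<^sup>2)"
      by (rule mult_right_mono) simp
    moreover have "(2 * (a + b))\<^sup>2 = 4 * (a + b)\<^sup>2"
      by (simp add: power2_eq_square algebra_simps)
    ultimately show ?thesis by simp
  next
    case False
    then have ba: "9/22 * a \<le> b" using ord by simp
    have "0 \<le> (31 * c - 9 * (a + b)) * (31466 * (a + b) - 29574 * c)"
      using ord False by (intro mult_nonneg_nonneg) auto
    also have "\<dots> = 961 * (646 * (a + b + c)\<^sup>2 - 1600 * c\<^sup>2) - 904000 * (a + b)\<^sup>2"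
      by (simp add: power2_eq_square algebra_simps)
    finally have "1600 * (a\<^sup>2 + b\<^sup>2 + c\<^sup>2) \<le> 646 * (a + b + c)\<^sup>2"
      using ab[OF ba] by simp
    then have "(1 + \<rho>)\<^sup>2 * (1600 * (a\<^sup>2 + b\<^sup>2 + c\<^sup>2)) \<le> (1 + \<rho>)\<^sup>2 * (646 * (a + b + c)\<^sup>2)"
      by (rule mult_left_mono) simp
    also have "\<dots> = (646 * (1 + \<rho>)\<^sup>2) * (a + b + c)\<^sup>2" by simp
    also have "\<dots> \<le> (961 * (1 + 2 * \<rho>\<^sup>2)) * (a + b + c)\<^sup>2"
      by (rule mult_right_mono[OF \<rho>2]) simp
    also have "\<dots> = 400 * ((31/20 * (a + b + c))\<^sup>2 * (1 + 2 * \<rho>\<^sup>2))"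
      by (simp add: power2_eq_square field_simps)
    also have "\<dots> \<le> 400 * (W\<^sup>2 * (1 + 2 * \<rho>\<^sup>2))"
      using W ord by (intro mult_left_mono mult_right_mono power_mono) auto
    finally show ?thesis by (simp add: algebra_simps)
  qed
qed

text \<open>961/150 is the squared width of the unit vector along (1 : 1 : 2). The critical vector
  is (1 : r : 9/31 (1 + r)), on which both width formulas agree; it satisfies the bound from about r
  = 0.5588 on, and 14/25 is a convenient fraction just above.\<close>

lemma sorted_width_bound_last:
  fixes a b c W :: real
  assumes ord: "0 \<le> c" "c \<le> b" "b \<le> a" and b: "14/25 * a \<le> b"
    and W: "2 * (a + b) \<le> W" "31/20 * (a + b + c) \<le> W"
  shows "961/150 * (a\<^sup>2 + b\<^sup>2 + c\<^sup>2) \<le> W\<^sup>2"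
proof -
  have "519 * (a + b)\<^sup>2 - 961 * (a\<^sup>2 + b\<^sup>2) =
      442 * ((b - 14/25 * a) * (a - b)) + 8712/25 * (a * (b - 14/25 * a)) + 418/625 * a\<^sup>2"
    by (simp add: power2_eq_square field_simps)
  also have "\<dots> \<ge> 0"
    using ord b by (intro add_nonneg_nonneg mult_nonneg_nonneg) auto
  finally have ab: "961 * (a\<^sup>2 + b\<^sup>2) \<le> 519 * (a + b)\<^sup>2"
    by simp
  show ?thesis
  proof (cases "c \<le> 9/31 * (a + b)")
    case True
    then have "c\<^sup>2 \<le> (9/31 * (a + b))\<^sup>2" using ord by (intro power_mono) auto
    also have "\<dots> = 81/961 * (a + b)\<^sup>2" by (simp add: power2_eq_square field_simps)
    finally have "961 * (a\<^sup>2 + b\<^sup>2 + c\<^sup>2) \<le> 600 * (a + b)\<^sup>2"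
      using ab by (simp add: distrib_left)
    moreover have "(2 * (a + b))\<^sup>2 \<le> W\<^sup>2" using W ord by (intro power_mono) auto
    moreover have "(2 * (a + b))\<^sup>2 = 4 * (a + b)\<^sup>2" by (simp add: power2_eq_square algebra_simps)
    ultimately show ?thesis by (simp add: distrib_left)
  next
    case False
    have "0 \<le> (31 * c - 9 * (a + b)) * (141 * (a + b) - 155 * c)"
      using ord False by (intro mult_nonneg_nonneg) auto
    also have "\<dots> = 961 * (3 * (a + b + c)\<^sup>2 - 8 * c\<^sup>2) - 4152 * (a + b)\<^sup>2"
      by (simp add: power2_eq_square algebra_simps)
    finally have "8 * (a\<^sup>2 + b\<^sup>2 + c\<^sup>2) \<le> 3 * (a + b + c)\<^sup>2"
      using ab by simp
    moreover have "(31/20 * (a + b + c))\<^sup>2 \<le> W\<^sup>2" using W ord by (intro power_mono) auto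
    moreover have "(31/20 * (a + b + c))\<^sup>2 = 961/400 * (a + b + c)\<^sup>2" by (simp add: power2_eq_square field_simps)
    ultimately show ?thesis by (simp add: distrib_left)
  qed
qed

lemma width_norm_perm: "width_norm a b c = width_norm b a c" "width_norm a b c = width_norm a c b"
  by (simp_all add: width_norm_def ac_simps)

lemma sort3:
  fixes P :: "real \<Rightarrow> real \<Rightarrow> real \<Rightarrow> bool"
  assumes "\<And>a b c. P a b c \<Longrightarrow> P b a c" "\<And>a b c. P a b c \<Longrightarrow> P a c b"
    and "\<And>a b c. \<bar>c\<bar> \<le> \<bar>b\<bar> \<Longrightarrow> \<bar>b\<bar> \<le> \<bar>a\<bar> \<Longrightarrow> P a b c"
  shows "P a b c"
  using assms by (metis linear)

text \<open>After sorting by absolute value, not being dominated means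
  \<open>\<rho> * \<bar>a\<bar> \<le> \<bar>b\<bar>\<close>. Equality holds at (1 : \<rho> :
  \<rho>), the shape of the probe vector, so nothing is lost when the two are compared.\<close>

lemma not_dominated_width_bound:
  assumes "0 \<le> \<rho>" "\<rho> \<le> 9/22" "\<not> dominated \<rho> a b c"
  shows "4 * (1 + \<rho>)\<^sup>2 * (a\<^sup>2 + b\<^sup>2 + c\<^sup>2) \<le> (width_norm a b c)\<^sup>2 * (1 + 2 * \<rho>\<^sup>2)"
proof -
  have "\<not> dominated \<rho> a b c \<longrightarrow> 4 * (1 + \<rho>)\<^sup>2 * (a\<^sup>2 + b\<^sup>2 + c\<^sup>2) \<le> (width_norm a b c)\<^sup>2 * (1 + 2 * \<rho>\<^sup>2)"
  proof (rule sort3[of _ a b c], goal_cases)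
    case (1 a b c)
    moreover have "dominated \<rho> b a c = dominated \<rho> a b c" by (auto simp: dominated_def)
    ultimately show ?case by (simp add: width_norm_perm(1)[of b] add.commute add.left_commute)
  next
    case (2 a b c)
    moreover have "dominated \<rho> a c b = dominated \<rho> a b c" by (auto simp: dominated_def)
    ultimately show ?case by (simp add: width_norm_perm(2)[of a c] add.commute add.left_commute)
  next
    case (3 a b c)
    show ?case
    proof
      assume "\<not> dominated \<rho> a b c"
      then have "\<rho> * \<bar>a\<bar> \<le> \<bar>b\<bar>" using 3 by (auto simp: dominated_def)
      from sorted_width_bound[OF _ 3 assms(1,2) this width_norm_ge(1)[of a b c] width_norm_ge(4)]
      show "4 * (1 + \<rho>)\<^sup>2 * (a\<^sup>2 + b\<^sup>2 + c\<^sup>2) \<le> (width_norm a b c)\<^sup>2 * (1 + 2 * \<rho>\<^sup>2)" by simp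
    qed
  qed
  then show ?thesis using assms by blast
qed

lemma not_dominated_width_bound_last:
  assumes "14/25 \<le> \<rho>" "\<not> dominated \<rho> a b c"
  shows "961/150 * (a\<^sup>2 + b\<^sup>2 + c\<^sup>2) \<le> (width_norm a b c)\<^sup>2"
proof -
  have "\<not> dominated \<rho> a b c \<longrightarrow> 961/150 * (a\<^sup>2 + b\<^sup>2 + c\<^sup>2) \<le> (width_norm a b c)\<^sup>2"
  proof (rule sort3[of _ a b c], goal_cases)
    case (1 a b c)
    moreover have "dominated \<rho> b a c = dominated \<rho> a b c" by (auto simp: dominated_def)
    ultimately show ?case by (simp add: width_norm_perm(1)[of b] add.commute add.left_commute)
  next
    case (2 a b c)
    moreover have "dominated \<rho> a c b = dominated \<rho> a b c" by (auto simp: dominated_def)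
    ultimately show ?case by (simp add: width_norm_perm(2)[of a c] add.commute add.left_commute)
  next
    case (3 a b c)
    show ?case
    proof
      assume "\<not> dominated \<rho> a b c"
      then have "\<rho> * \<bar>a\<bar> \<le> \<bar>b\<bar>" using 3 by (auto simp: dominated_def)
      moreover have "14/25 * \<bar>a\<bar> \<le> \<rho> * \<bar>a\<bar>" using assms(1) by (rule mult_right_mono) simp
      ultimately have "14/25 * \<bar>a\<bar> \<le> \<bar>b\<bar>" by simp
      from sorted_width_bound_last[OF _ 3 this width_norm_ge(1)[of a b c] width_norm_ge(4)]
      show "961/150 * (a\<^sup>2 + b\<^sup>2 + c\<^sup>2) \<le> (width_norm a b c)\<^sup>2" by simp
    qed
  qed
  then show ?thesis using assms by blast
qed

section \<open>A narrow direction in the plane of the second pose\<close>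

text \<open>The two rows of the projection matrix are an orthonormal basis of the plane orthogonal
  to the view direction; \<open>p\<close> and \<open>w\<close> are the coordinates of (x, y, z) in
  it, and t is their polar angle.\<close>

lemma view_vec_surj:
  assumes "x\<^sup>2 + y\<^sup>2 + z\<^sup>2 = 1" "cos \<theta> * sin \<phi> * x + sin \<theta> * sin \<phi> * y + cos \<phi> * z = 0"
  obtains t where "t \<in> {0..2*pi}" "view_vec \<theta> \<phi> t 0 = x" "view_vec \<theta> \<phi> t 1 = y" "view_vec \<theta> \<phi> t 2 = z"
proof -
  define p where "p = - sin \<theta> * x + cos \<theta> * y"
  define w where "w = - cos \<theta> * cos \<phi> * x - sin \<theta> * cos \<phi> * y + sin \<phi> * z"
  have sc: "sin \<theta> ^ 2 + cos \<theta> ^ 2 = 1" "sin \<phi> ^ 2 + cos \<phi> ^ 2 = 1" by simp_all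
  have "p\<^sup>2 + w\<^sup>2 = 1"
    using assms sc unfolding p_def w_def by algebra
  then obtain t where t: "0 \<le> t" "t \<le> 2*pi" "p = cos t" "w = sin t"
    using sincos_total_2pi_le by metis
  have "view_vec \<theta> \<phi> t 0 = x"
    using assms sc unfolding view_vec_def t(3,4)[symmetric] p_def w_def by (simp, algebra)
  moreover have "view_vec \<theta> \<phi> t 1 = y"
    using assms sc unfolding view_vec_def t(3,4)[symmetric] p_def w_def by (simp, algebra)
  moreover have "view_vec \<theta> \<phi> t 2 = z"
    using assms sc unfolding view_vec_def t(3,4)[symmetric] p_def w_def by (simp, algebra)
  ultimately show ?thesis using that t(1,2) by simp
qed

text \<open>The witness is \<open>(\<plusminus>k, \<plusminus>k, \<plusminus>m)\<close>, normalized, with \<open>k = \<bar>z\<bar>\<close> and \<open>m = \<bar>x\<bar> + \<bar>y\<bar>\<close>.\<close>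

lemma probe_direction:
  fixes x y z \<rho> :: real
  assumes "\<bar>z\<bar> \<le> \<rho> * (\<bar>x\<bar> + \<bar>y\<bar>)" "x\<^sup>2 + y\<^sup>2 + z\<^sup>2 = 1" and \<rho>: "0 \<le> \<rho>" "\<rho> \<le> 1/2"
  obtains a b c where "a\<^sup>2 + b\<^sup>2 + c\<^sup>2 = 1" "x * a + y * b + z * c = 0"
    "\<rho> \<le> 9/22 \<Longrightarrow> (width_norm a b c)\<^sup>2 * (1 + 2 * \<rho>\<^sup>2) \<le> 4 * (1 + \<rho>)\<^sup>2"
    "(width_norm a b c)\<^sup>2 \<le> 961/150"
proof -
  define m where "m = \<bar>x\<bar> + \<bar>y\<bar>"
  define k where "k = \<bar>z\<bar>"
  have "m \<noteq> 0"
  proof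
    assume "m = 0"
    then have "\<bar>z\<bar> \<le> \<rho> * 0" "\<bar>x\<bar> + \<bar>y\<bar> = 0" using assms(1) unfolding m_def by metis+
    then have "x = 0" "y = 0" "z = 0" by auto
    then show False using assms(2) by simp
  qed
  then have m: "m > 0" by (auto simp: m_def)
  have k: "0 \<le> k" "k \<le> \<rho> * m" using assms(1) by (auto simp: k_def m_def)
  define l where "l = sqrt (2 * k\<^sup>2 + m\<^sup>2)"
  have l: "l > 0" "l\<^sup>2 = 2 * k\<^sup>2 + m\<^sup>2"
    using m by (auto simp: l_def add_nonneg_pos)
  have sg: "x * (if x < 0 then -1 else 1) = \<bar>x\<bar>" "y * (if y < 0 then -1 else 1) = \<bar>y\<bar>"
    "z * (if z < 0 then 1 else -1) = - k" by (auto simp: k_def)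
  define a b c where "a = (if x < 0 then -1 else 1) * k / l" and "b = (if y < 0 then -1 else 1) * k / l"
    and "c = (if z < 0 then 1 else -1) * m / l"
  have abs: "\<bar>a\<bar> = k / l" "\<bar>b\<bar> = k / l" "\<bar>c\<bar> = m / l"
    using k m l by (auto simp: a_def b_def c_def abs_mult)
  have "a\<^sup>2 + b\<^sup>2 + c\<^sup>2 = (k / l)\<^sup>2 + (k / l)\<^sup>2 + (m / l)\<^sup>2"
    using abs by (metis power2_abs)
  also have "\<dots> = (2 * k\<^sup>2 + m\<^sup>2) / l\<^sup>2"
    by (simp add: power_divide add_divide_distrib)
  also have "\<dots> = 1"
    using l by (simp flip: l(2))
  finally have unit: "a\<^sup>2 + b\<^sup>2 + c\<^sup>2 = 1" .
  have "x * a + y * b + z * c = (\<bar>x\<bar> * k + \<bar>y\<bar> * k - k * m) / l"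
    unfolding a_def b_def c_def times_divide_eq_right add_divide_distrib[symmetric]
      mult.assoc[symmetric] sg by simp
  also have "\<dots> = 0" by (simp add: m_def algebra_simps)
  finally have orth: "x * a + y * b + z * c = 0" .
  have k2: "2 * k \<le> m"
    using k(2) mult_right_mono[OF \<rho>(2), of m] m by linarith
  have small: "(width_norm a b c)\<^sup>2 * (1 + 2 * \<rho>\<^sup>2) \<le> 4 * (1 + \<rho>)\<^sup>2" if "\<rho> \<le> 9/22"
  proof -
    \<comment> \<open>For k/m at most 9/22 the width of (k, k, m) is 2 (k + m), not 31/20 (2 k +
      m).\<close>
    have "k \<le> 9/22 * m" using k(2) mult_right_mono[OF that, of m] m by linarith
    then have "width_norm a b c \<le> 2 * (k + m) / l"
      using k m l by (intro width_norm_le; simp add: abs field_simps)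
    then have "(width_norm a b c)\<^sup>2 \<le> (2 * (k + m) / l)\<^sup>2"
      using width_norm_ge(4)[of a b c] by (intro power_mono) auto
    also have "\<dots> = 4 * (k + m)\<^sup>2 / l\<^sup>2" by (simp add: power2_eq_square algebra_simps)
    finally have *: "(width_norm a b c)\<^sup>2 * l\<^sup>2 \<le> 4 * (k + m)\<^sup>2"
      using l(1) by (simp add: pos_le_divide_eq)
    have "\<rho> * k \<le> 1/2 * k" "\<rho> * m \<le> 1/2 * m" using \<rho> k m by (intro mult_right_mono; simp)+
    \<comment> \<open>Monotonicity of (1 + r)^2 / (1 + 2 r^2) for r up to 1/2, from r = k/m to r =
      \<rho>, in factored form.\<close>
    then have "0 \<le> (\<rho> * m - k) * (2 * m - k - \<rho> * m - 4 * (\<rho> * k))"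
      using k m k2 by (intro mult_nonneg_nonneg; linarith)
    also have "\<dots> = (1 + \<rho>)\<^sup>2 * l\<^sup>2 - (k + m)\<^sup>2 * (1 + 2 * \<rho>\<^sup>2)"
      unfolding l(2) by (simp add: power2_eq_square algebra_simps)
    finally have **: "(k + m)\<^sup>2 * (1 + 2 * \<rho>\<^sup>2) \<le> (1 + \<rho>)\<^sup>2 * l\<^sup>2" by simp
    have "(width_norm a b c)\<^sup>2 * l\<^sup>2 * (1 + 2 * \<rho>\<^sup>2) \<le> 4 * (k + m)\<^sup>2 * (1 + 2 * \<rho>\<^sup>2)"
      using * by (rule mult_right_mono) simp
    also have "\<dots> \<le> 4 * (1 + \<rho>)\<^sup>2 * l\<^sup>2" using ** by simp
    finally have "((width_norm a b c)\<^sup>2 * (1 + 2 * \<rho>\<^sup>2)) * l\<^sup>2 \<le> (4 * (1 + \<rho>)\<^sup>2) * l\<^sup>2"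
      by (simp add: ac_simps)
    then show ?thesis by (rule mult_right_le_imp_le) (use l(1) in simp)
  qed
  have "width_norm a b c \<le> max (2 * (k + m)) (31/20 * (2 * k + m)) / l"
    using k m l k2 by (intro width_norm_le; simp add: abs field_simps le_max_iff_disj)
  then have "(width_norm a b c)\<^sup>2 \<le> (max (2 * (k + m)) (31/20 * (2 * k + m)) / l)\<^sup>2"
    using width_norm_ge(4)[of a b c] by (intro power_mono) auto
  also have "\<dots> \<le> 961/150"
  proof -
    \<comment> \<open>One inequality for each candidate in the maximum: the first is a completed
      square, the second vanishes at m = 2 k, where 961/150 is attained.\<close>
    have "0 \<le> (361 * m - 600 * k)\<^sup>2 + 117242 * (k * k)" "0 \<le> (m - 2 * k) * (5 * m - 2 * k)"
      using k k2 m by simp_all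
    then have "(2 * (k + m))\<^sup>2 \<le> 961/150 * l\<^sup>2" "(31/20 * (2 * k + m))\<^sup>2 \<le> 961/150 * l\<^sup>2"
      unfolding l(2) by (simp_all add: power2_eq_square field_simps)
    then have "(max (2 * (k + m)) (31/20 * (2 * k + m)))\<^sup>2 \<le> 961/150 * l\<^sup>2"
      by (auto simp: max_def)
    then show ?thesis using l(1) by (simp add: power_divide field_simps)
  qed
  finally show ?thesis using that unit orth small by blast
qed

section \<open>Measures of trigonometric sets\<close>

lemma emeasure_lborel_shift:
  fixes Q :: "real \<Rightarrow> bool"
  assumes [measurable]: "Measurable.pred borel Q"
  shows "emeasure lborel {x. Q (x + c)} = emeasure lborel {x. Q x}"
proof -
  have "emeasure lborel {x. Q x} = emeasure (distr lborel borel ((+) c)) {x. Q x}"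
    by (simp only: lborel_distr_plus)
  also have "\<dots> = emeasure lborel {x. Q (x + c)}"
    by (subst emeasure_distr) (auto simp: vimage_def add.commute)
  finally show ?thesis ..
qed

text \<open>After reduction of c modulo T to \<open>d\<close>, the shifted period is cut where it
  wraps around, and each piece is translated back into the original period.\<close>

lemma emeasure_periodic_shift_le:
  fixes P :: "real \<Rightarrow> bool"
  assumes T: "T > 0" and [measurable]: "Measurable.pred borel P" and per: "\<And>x. P (x + T) = P x"
  shows "emeasure lborel {x \<in> {0..T}. P (x + c)} \<le> emeasure lborel {x \<in> {0..T}. P x}"
proof -
  have pern: "P (x + real n * T) = P x" for x n
  proof (induction n arbitrary: x)
    case (Suc n)
    have "P (x + real (Suc n) * T) = P ((x + real n * T) + T)" by (simp add: algebra_simps)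
    then show ?case using per Suc by simp
  qed simp
  have peri: "P (x + of_int k * T) = P x" for x k
  proof (cases "k \<ge> 0")
    case True
    then show ?thesis using pern[of x "nat k"] by simp
  next
    case False
    then show ?thesis using pern[of "x + of_int k * T" "nat (- k)"] by simp
  qed
  define d where "d = c - of_int \<lfloor>c / T\<rfloor> * T"
  have d: "0 \<le> d" "d < T"
  proof -
    have "of_int \<lfloor>c / T\<rfloor> \<le> c / T" "c / T < of_int \<lfloor>c / T\<rfloor> + 1" by linarith+
    then have "of_int \<lfloor>c / T\<rfloor> * T \<le> c" "c < (of_int \<lfloor>c / T\<rfloor> + 1) * T"
      using T by (simp_all only: pos_le_divide_eq pos_divide_less_eq)
    then show "0 \<le> d" "d < T" by (simp_all add: d_def algebra_simps)
  qed
  have Pc: "P (x + c) = P (x + d)" for x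
    using peri[of "x + d" "\<lfloor>c / T\<rfloor>"] by (simp add: d_def)
  have Pd: "P (x + d) = P (x + (d - T))" for x
    using per[of "x + (d - T)"] by simp
  let ?A1 = "{x. x + d \<in> {d<..T} \<and> P (x + d)}" and ?A2 = "{x. x + (d - T) \<in> {0<..d} \<and> P (x + (d - T))}"
  \<comment> \<open>Half-open pieces keep the translated sets disjoint, so that their measures add
    up exactly; the endpoint 0 left out is a null set.\<close>
  have "{x \<in> {0..T}. P (x + c)} \<subseteq> {0} \<union> (?A1 \<union> ?A2)"
    using Pd d by (auto simp: Pc)
  then have "emeasure lborel {x \<in> {0..T}. P (x + c)} \<le> emeasure lborel ({0} \<union> (?A1 \<union> ?A2))"
    by (rule emeasure_mono) measurable
  also have "\<dots> \<le> emeasure lborel {0::real} + (emeasure lborel ?A1 + emeasure lborel ?A2)"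
    by (intro order_trans[OF emeasure_subadditive] add_mono order_refl emeasure_subadditive) measurable
  also have "\<dots> = emeasure lborel {x. x \<in> {d<..T} \<and> P x} + emeasure lborel {x. x \<in> {0<..d} \<and> P x}"
    by (subst (1 2) emeasure_lborel_shift) simp_all
  also have "\<dots> = emeasure lborel ({x. x \<in> {d<..T} \<and> P x} \<union> {x. x \<in> {0<..d} \<and> P x})"
    by (rule plus_emeasure) auto
  also have "\<dots> \<le> emeasure lborel {x \<in> {0..T}. P x}"
    using d by (intro emeasure_mono) auto
  finally show ?thesis .
qed

lemma sin_le_iff: "0 \<le> x \<Longrightarrow> x \<le> pi/2 \<Longrightarrow> 0 \<le> y \<Longrightarrow> y \<le> pi/2 \<Longrightarrow> sin x \<le> sin y \<longleftrightarrow> x \<le> y"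
  by (rule sin_mono_le_eq) auto

text \<open>The shift c disappears by periodicity; what remains is one arc of length b - a in each
  quarter of the circle.\<close>

lemma emeasure_abs_sin_band:
  assumes "0 \<le> a" "a \<le> b" "b \<le> pi/2"
  shows "emeasure lborel {t \<in> {0..2*pi}. sin a \<le> \<bar>sin (t + c)\<bar> \<and> \<bar>sin (t + c)\<bar> \<le> sin b} \<le> ennreal (4 * (b - a))"
proof -
  have "emeasure lborel {t \<in> {0..2*pi}. sin a \<le> \<bar>sin (t + c)\<bar> \<and> \<bar>sin (t + c)\<bar> \<le> sin b} \<le>
      emeasure lborel {t \<in> {0..2*pi}. sin a \<le> \<bar>sin t\<bar> \<and> \<bar>sin t\<bar> \<le> sin b}"
    by (rule emeasure_periodic_shift_le[where P = "\<lambda>t. sin a \<le> \<bar>sin t\<bar> \<and> \<bar>sin t\<bar> \<le> sin b"]) auto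
  also have "\<dots> \<le> emeasure lborel (({a..b} \<union> {pi - b..pi - a}) \<union> ({pi + a..pi + b} \<union> {2*pi - b..2*pi - a}))"
  proof (rule emeasure_mono)
    show "{t \<in> {0..2*pi}. sin a \<le> \<bar>sin t\<bar> \<and> \<bar>sin t\<bar> \<le> sin b} \<subseteq>
        ({a..b} \<union> {pi - b..pi - a}) \<union> ({pi + a..pi + b} \<union> {2*pi - b..2*pi - a})"
    proof
      fix t assume t: "t \<in> {t \<in> {0..2*pi}. sin a \<le> \<bar>sin t\<bar> \<and> \<bar>sin t\<bar> \<le> sin b}"
      have key: "a \<le> s \<and> s \<le> b" if "0 \<le> s" "s \<le> pi/2" "\<bar>sin t\<bar> = sin s" for s
        using t that assms by (auto simp: sin_le_iff)
      consider "t \<le> pi/2" | "pi/2 \<le> t" "t \<le> pi" | "pi \<le> t" "t \<le> 3*pi/2" | "3*pi/2 \<le> t" by linarith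
      then show "t \<in> ({a..b} \<union> {pi - b..pi - a}) \<union> ({pi + a..pi + b} \<union> {2*pi - b..2*pi - a})"
      proof cases
        case 1
        then show ?thesis using key[of t] t sin_ge_zero[of t] by auto
      next
        case 2
        then show ?thesis using key[of "pi - t"] t sin_ge_zero[of t] by auto
      next
        case 3
        then show ?thesis using key[of "t - pi"] t sin_ge_zero[of "t - pi"] by (auto simp: sin_diff)
      next
        case 4
        then show ?thesis using key[of "2*pi - t"] t sin_ge_zero[of "2*pi - t"] by (auto simp: sin_diff)
      qed
    qed
  qed auto
  also have "\<dots> \<le> (emeasure lborel {a..b} + emeasure lborel {pi - b..pi - a}) +
      (emeasure lborel {pi + a..pi + b} + emeasure lborel {2*pi - b..2*pi - a})"
    by (intro order_trans[OF emeasure_subadditive] add_mono emeasure_subadditive) auto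
  also have "\<dots> = ennreal (4 * (b - a))"
    using assms by (simp flip: ennreal_plus)
  finally show ?thesis .
qed

text \<open>A quarter turn exchanges the absolute values of sine and cosine, so the condition has
  period pi/2. The range of \<theta> is exactly one period, which makes the phase c
  irrelevant.\<close>

lemma emeasure_near_axis:
  assumes "0 \<le> k" "k \<le> pi/2"
  shows "emeasure lborel {t \<in> {0..pi/2}. \<bar>sin (t + c)\<bar> \<le> sin k \<or> \<bar>cos (t + c)\<bar> \<le> sin k} \<le> ennreal (2 * k)"
proof -
  have "emeasure lborel {t \<in> {0..pi/2}. \<bar>sin (t + c)\<bar> \<le> sin k \<or> \<bar>cos (t + c)\<bar> \<le> sin k} \<le>
      emeasure lborel {t \<in> {0..pi/2}. \<bar>sin t\<bar> \<le> sin k \<or> \<bar>cos t\<bar> \<le> sin k}"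
    by (rule emeasure_periodic_shift_le[where P = "\<lambda>t. \<bar>sin t\<bar> \<le> sin k \<or> \<bar>cos t\<bar> \<le> sin k"])
      (auto simp: sin_add cos_add)
  also have "\<dots> \<le> emeasure lborel ({0..k} \<union> {pi/2 - k..pi/2})"
  proof (rule emeasure_mono)
    show "{t \<in> {0..pi/2}. \<bar>sin t\<bar> \<le> sin k \<or> \<bar>cos t\<bar> \<le> sin k} \<subseteq> {0..k} \<union> {pi/2 - k..pi/2}"
    proof
      fix t assume t: "t \<in> {t \<in> {0..pi/2}. \<bar>sin t\<bar> \<le> sin k \<or> \<bar>cos t\<bar> \<le> sin k}"
      then have "sin t \<le> sin k \<or> sin (pi/2 - t) \<le> sin k" by (auto simp: sin_diff)
      then show "t \<in> {0..k} \<union> {pi/2 - k..pi/2}"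
        using t assms sin_le_iff[of t k] sin_le_iff[of "pi/2 - t" k] by auto
    qed
  qed auto
  also have "\<dots> \<le> emeasure lborel {0..k} + emeasure lborel {pi/2 - k..pi/2}"
    by (rule emeasure_subadditive) auto
  also have "\<dots> = ennreal (2 * k)"
    using assms by (simp flip: ennreal_plus)
  finally show ?thesis .
qed

text \<open>For fixed \<phi> and t, varying \<theta> rotates the vector about the third axis: its
  height is sin \<phi> * sin t and its horizontal part has constant length with phase
  \<open>\<theta> + c\<close>. The first alternative is nearness to the third axis; the second is
  nearness to one of the others, where both the height and the angle to the axis are
  restricted.\<close>

lemma dominated_imp:
  assumes "0 \<le> k" "k < pi/2"
  obtains c where "\<And>\<theta>. dominated (tan k) (view_vec \<theta> \<phi> t 0) (view_vec \<theta> \<phi> t 1) (view_vec \<theta> \<phi> t 2) \<Longrightarrow>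
      (cos k)\<^sup>2 < (sin \<phi>)\<^sup>2 * (sin t)\<^sup>2 * (1 + (sin k)\<^sup>2) \<or>
      (\<bar>sin \<phi> * sin t\<bar> < sin k \<and> (\<bar>sin (\<theta> + c)\<bar> \<le> sin k \<or> \<bar>cos (\<theta> + c)\<bar> \<le> sin k))"
proof -
  have ck: "cos k > 0" using assms by (intro cos_gt_zero_pi) auto
  have sk: "sin k \<ge> 0" using assms by (intro sin_ge_zero) auto
  have sck: "(sin k)\<^sup>2 + (cos k)\<^sup>2 = 1" by simp
  define p w where "p = cos t" and "w = cos \<phi> * sin t"
  define s where "s = sqrt (p\<^sup>2 + w\<^sup>2)"
  have s: "s \<ge> 0" "s\<^sup>2 = p\<^sup>2 + w\<^sup>2" by (simp_all add: s_def)
  obtain c where c: "p = s * cos c" "w = s * sin c"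
  proof (cases "s = 0")
    case True
    then have "p = 0" "w = 0" using s(2) by (simp_all add: sum_power2_eq_zero_iff eq_commute[of 0])
    then show ?thesis using that[of 0] True by simp
  next
    case False
    then have "(p / s)\<^sup>2 + (w / s)\<^sup>2 = 1" by (simp add: power_divide flip: add_divide_distrib s(2))
    then obtain c where "p / s = cos c" "w / s = sin c" using sincos_total_2pi_le by blast
    then show ?thesis using that[of c] False by (simp add: field_simps)
  qed
  show ?thesis
  proof (rule that[of c])
    fix \<theta>
    let ?x = "view_vec \<theta> \<phi> t 0" and ?y = "view_vec \<theta> \<phi> t 1" and ?z = "view_vec \<theta> \<phi> t 2"
    assume dom: "dominated (tan k) ?x ?y ?z"
    have x: "?x = - s * sin (\<theta> + c)" and y: "?y = s * cos (\<theta> + c)" and z: "?z = sin \<phi> * sin t"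
      using c by (simp_all add: view_vec_def p_def w_def sin_add cos_add algebra_simps)
    have unit: "?x\<^sup>2 + ?y\<^sup>2 + ?z\<^sup>2 = 1" by (rule view_vec_norm)
    have sq: "u\<^sup>2 * (cos k)\<^sup>2 < (sin k)\<^sup>2 * v\<^sup>2" if "\<bar>u\<bar> < tan k * \<bar>v\<bar>" for u v
    proof -
      have "\<bar>u\<bar> * cos k < sin k * \<bar>v\<bar>" using that ck by (simp add: tan_def field_simps)
      then have "(\<bar>u\<bar> * cos k)\<^sup>2 < (sin k * \<bar>v\<bar>)\<^sup>2"
        using ck by (intro power_strict_mono) auto
      then show ?thesis by (simp add: power_mult_distrib)
    qed
    have conc: "\<bar>u\<bar> < sin k" if "u\<^sup>2 < (sin k)\<^sup>2" for u
      using that sk abs_le_square_iff[of "sin k" u] by (auto simp: not_le[symmetric])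
    \<comment> \<open>Turns a tangent bound between two parts u and v - u of a sum into a sine bound
      of u against the total v.\<close>
    have elim: "u < (sin k)\<^sup>2 * v" if "u * (cos k)\<^sup>2 < (sin k)\<^sup>2 * (v - u)" for u v
      using that by (simp add: cos_squared_eq algebra_simps)
    have xy: "?x\<^sup>2 + ?y\<^sup>2 = s\<^sup>2" unfolding x y power_mult_distrib by (simp flip: distrib_left)
    consider (x) "\<bar>?y\<bar> < tan k * \<bar>?x\<bar>" "\<bar>?z\<bar> < tan k * \<bar>?x\<bar>" | (y) "\<bar>?x\<bar> < tan k * \<bar>?y\<bar>" "\<bar>?z\<bar> < tan k * \<bar>?y\<bar>"
      | (z) "\<bar>?x\<bar> < tan k * \<bar>?z\<bar>" "\<bar>?y\<bar> < tan k * \<bar>?z\<bar>"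
      using dom unfolding dominated_def by blast
    then show "(cos k)\<^sup>2 < (sin \<phi>)\<^sup>2 * (sin t)\<^sup>2 * (1 + (sin k)\<^sup>2) \<or>
      (\<bar>sin \<phi> * sin t\<bar> < sin k \<and> (\<bar>sin (\<theta> + c)\<bar> \<le> sin k \<or> \<bar>cos (\<theta> + c)\<bar> \<le> sin k))"
    proof cases
      case x
      have "?z\<^sup>2 * (cos k)\<^sup>2 < (sin k)\<^sup>2 * ?x\<^sup>2" by (rule sq[OF x(2)])
      also have "\<dots> \<le> (sin k)\<^sup>2 * (1 - ?z\<^sup>2)"
        using unit zero_le_power2[of ?y] by (intro mult_left_mono zero_le_power2) linarith
      finally have "?z\<^sup>2 < (sin k)\<^sup>2 * 1" by (rule elim)
      then have "\<bar>?z\<bar> < sin k" by (intro conc) simp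
      moreover have e: "?x\<^sup>2 = s\<^sup>2 - ?y\<^sup>2" using xy by simp
      have "?y\<^sup>2 < (sin k)\<^sup>2 * s\<^sup>2" by (rule elim[OF sq[OF x(1), unfolded e]])
      then have "(cos (\<theta> + c))\<^sup>2 < (sin k)\<^sup>2"
        unfolding y power_mult_distrib by (simp add: mult.commute mult_less_cancel_left_disj)
      then have "\<bar>cos (\<theta> + c)\<bar> < sin k" by (rule conc)
      ultimately show ?thesis unfolding z by simp
    next
      case y
      have "?z\<^sup>2 * (cos k)\<^sup>2 < (sin k)\<^sup>2 * ?y\<^sup>2" by (rule sq[OF y(2)])
      also have "\<dots> \<le> (sin k)\<^sup>2 * (1 - ?z\<^sup>2)"
        using unit zero_le_power2[of ?x] by (intro mult_left_mono zero_le_power2) linarith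
      finally have "?z\<^sup>2 < (sin k)\<^sup>2 * 1" by (rule elim)
      then have "\<bar>?z\<bar> < sin k" by (intro conc) simp
      moreover have e: "?y\<^sup>2 = s\<^sup>2 - ?x\<^sup>2" using xy by simp
      have "?x\<^sup>2 < (sin k)\<^sup>2 * s\<^sup>2" by (rule elim[OF sq[OF y(1), unfolded e]])
      then have "(sin (\<theta> + c))\<^sup>2 < (sin k)\<^sup>2"
        unfolding x power_mult_distrib by (simp add: mult.commute mult_less_cancel_left_disj)
      then have "\<bar>sin (\<theta> + c)\<bar> < sin k" by (rule conc)
      ultimately show ?thesis unfolding z by simp
    next
      case z
      \<comment> \<open>Adding the two bounds replaces the square section of the pyramid by its
        circumscribed disc, which depends only on the height and not on \<theta>.\<close>
      have "(?x\<^sup>2 + ?y\<^sup>2) * (cos k)\<^sup>2 < 2 * ((sin k)\<^sup>2 * ?z\<^sup>2)"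
        using sq[OF z(1)] sq[OF z(2)] by (simp add: distrib_right)
      moreover have "?x\<^sup>2 + ?y\<^sup>2 = 1 - ?z\<^sup>2" using unit by simp
      moreover have "C < Z * (1 + S)" if "(1 - Z) * C < 2 * (S * Z)" "C = 1 - S" for Z S C :: real
        using that by (simp add: algebra_simps)
      ultimately have "(cos k)\<^sup>2 < ?z\<^sup>2 * (1 + (sin k)\<^sup>2)"
        by (metis cos_squared_eq)
      then show ?thesis unfolding \<open>?z = sin \<phi> * sin t\<close> by (simp add: power_mult_distrib)
    qed
  qed
qed

section \<open>Covering by columns of one degree\<close>

text \<open>A Riemann-type upper bound. The cells may overlap, as closed degree intervals do at
  their endpoints: summing over all cells only increases the right-hand side.\<close>

lemma nn_integral_cover_le:
  fixes C :: "nat \<Rightarrow> 'a set" and c :: "nat \<Rightarrow> real"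
  assumes cover: "A \<subseteq> (\<Union>i<n. C i)"
    and C: "\<And>i. i < n \<Longrightarrow> C i \<in> sets M" "\<And>i. i < n \<Longrightarrow> emeasure M (C i) \<le> ennreal d" "0 \<le> d"
    and g: "\<And>i x. i < n \<Longrightarrow> x \<in> A \<Longrightarrow> x \<in> C i \<Longrightarrow> g x \<le> ennreal (c i)"
    and c: "\<And>i. i < n \<Longrightarrow> 0 \<le> c i"
  shows "(\<integral>\<^sup>+x. g x * indicator A x \<partial>M) \<le> ennreal (d * (\<Sum>i<n. c i))"
proof -
  have "g x * indicator A x \<le> (\<Sum>i<n. ennreal (c i) * indicator (C i) x)" for x
  proof (cases "x \<in> A")
    case True
    then obtain i where i: "i < n" "x \<in> C i" using cover by blast
    have "g x * indicator A x \<le> ennreal (c i) * indicator (C i) x"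
      using g[OF i(1) True i(2)] True i(2) by simp
    also have "\<dots> \<le> (\<Sum>i<n. ennreal (c i) * indicator (C i) x)"
      by (rule member_le_sum) (use i in auto)
    finally show ?thesis .
  qed simp
  then have "(\<integral>\<^sup>+x. g x * indicator A x \<partial>M) \<le> (\<integral>\<^sup>+x. (\<Sum>i<n. ennreal (c i) * indicator (C i) x) \<partial>M)"
    by (intro nn_integral_mono)
  also have "\<dots> = (\<Sum>i<n. ennreal (c i) * emeasure M (C i))"
    using C(1) by (subst nn_integral_sum) (auto simp: nn_integral_cmult_indicator)
  also have "\<dots> \<le> (\<Sum>i<n. ennreal (c i) * ennreal d)"
    using C(2) by (intro sum_mono mult_left_mono) auto
  also have "\<dots> = (\<Sum>i<n. ennreal (d * c i))"
    using C(3) c by (intro sum.cong refl) (simp add: ennreal_mult mult.commute)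
  also have "\<dots> = ennreal (\<Sum>i<n. d * c i)"
    using C(3) c by (intro sum_ennreal) auto
  finally show ?thesis by (simp add: sum_distrib_left)
qed

text \<open>The slice at fixed \<phi> of the first poses that survive the probe:
  \<open>\<beta>\<close> is the probe direction of the second pose and
  \<open>\<beta> - \<alpha>\<close> the direction of the first pose that the rotation carries onto
  it.\<close>

definition rel_dominated :: "real \<Rightarrow> real \<Rightarrow> real \<Rightarrow> (real \<times> real) set" where
  "rel_dominated k \<phi> \<beta> = {(\<alpha>, \<theta>). \<alpha> \<in> {0..2*pi} \<and> \<theta> \<in> {0..pi/2} \<and>
     dominated (tan k) (view_vec \<theta> \<phi> (\<beta> - \<alpha>) 0) (view_vec \<theta> \<phi> (\<beta> - \<alpha>) 1) (view_vec \<theta> \<phi> (\<beta> - \<alpha>) 2)}"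

lemma view_vec_measurable [measurable (raw)]:
  assumes [measurable]: "f \<in> borel_measurable M" "g \<in> borel_measurable M" "h \<in> borel_measurable M"
  shows "(\<lambda>x. view_vec (f x) (g x) (h x) i) \<in> borel_measurable M"
  unfolding view_vec_def by measurable

lemma rel_dominated_measurable [measurable]: "rel_dominated k \<phi> \<beta> \<in> sets borel"
proof -
  have "rel_dominated k \<phi> \<beta> = {p \<in> space (borel \<Otimes>\<^sub>M borel). fst p \<in> {0..2*pi} \<and> snd p \<in> {0..pi/2} \<and>
     dominated (tan k) (view_vec (snd p) \<phi> (\<beta> - fst p) 0) (view_vec (snd p) \<phi> (\<beta> - fst p) 1)
       (view_vec (snd p) \<phi> (\<beta> - fst p) 2)}"
    by (auto simp: rel_dominated_def space_pair_measure)
  also have "\<dots> \<in> sets (borel \<Otimes>\<^sub>M borel)"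
    unfolding dominated_def by measurable
  finally show ?thesis unfolding borel_prod .
qed

text \<open>The height \<open>sin \<phi> * sin (\<beta> - \<alpha>)\<close> admits a set of \<alpha>
  of measure 4 h for the lateral axes, each with at most 2 k of \<theta>, and one of measure 4 (pi/2
  - x) for the cap, each with the full range pi/2 of \<theta>. The choice h = pi/2 stands for no
  restriction on \<alpha>. The bound does not involve \<beta>: this is how only \<open>q\<close> of
  the second pose matters.\<close>

lemma emeasure_rel_dominated:
  assumes k: "0 < k" "k < pi/2" and h: "0 \<le> h" "h \<le> pi/2" and x: "0 \<le> x" "x \<le> pi/2"
    and hh: "h = pi/2 \<or> sin k \<le> \<bar>sin \<phi>\<bar> * sin h"
    and xx: "(sin \<phi>)\<^sup>2 * (sin x)\<^sup>2 * (1 + (sin k)\<^sup>2) \<le> (cos k)\<^sup>2"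
  shows "emeasure lborel (rel_dominated k \<phi> \<beta>) \<le> ennreal (8 * h * k + 2 * pi * (pi/2 - x))"
proof -
  define S1 where "S1 = {t \<in> {0..2*pi}. sin 0 \<le> \<bar>sin (t + (- \<beta>))\<bar> \<and> \<bar>sin (t + (- \<beta>))\<bar> \<le> sin h}"
  define S2 where "S2 = {t \<in> {0..2*pi}. sin x \<le> \<bar>sin (t + (- \<beta>))\<bar> \<and> \<bar>sin (t + (- \<beta>))\<bar> \<le> sin (pi/2)}"
  have [measurable]: "S1 \<in> sets borel" "S2 \<in> sets borel" by (simp_all add: S1_def S2_def)
  have "emeasure lborel (rel_dominated k \<phi> \<beta>) = (\<integral>\<^sup>+\<alpha>. emeasure lborel (Pair \<alpha> -` rel_dominated k \<phi> \<beta>) \<partial>lborel)"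
    by (subst lborel_prod[symmetric], rule lborel.emeasure_pair_measure_alt)
      (simp only: lborel_prod sets_lborel rel_dominated_measurable)
  also have "\<dots> \<le> (\<integral>\<^sup>+\<alpha>. ennreal (2 * k) * indicator S1 \<alpha> + ennreal (pi/2) * indicator S2 \<alpha> \<partial>lborel)"
  proof (rule nn_integral_mono)
    fix \<alpha> :: real
    let ?A = "Pair \<alpha> -` rel_dominated k \<phi> \<beta>"
    let ?I = "ennreal (2 * k) * indicator S1 \<alpha> + ennreal (pi/2) * indicator S2 \<alpha>"
    obtain c where c: "\<And>\<theta>. \<theta> \<in> ?A \<Longrightarrow>
      (cos k)\<^sup>2 < (sin \<phi>)\<^sup>2 * (sin (\<beta> - \<alpha>))\<^sup>2 * (1 + (sin k)\<^sup>2) \<or>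
      (\<bar>sin \<phi> * sin (\<beta> - \<alpha>)\<bar> < sin k \<and> (\<bar>sin (\<theta> + c)\<bar> \<le> sin k \<or> \<bar>cos (\<theta> + c)\<bar> \<le> sin k))"
    proof -
      obtain c where "\<And>\<theta>. dominated (tan k) (view_vec \<theta> \<phi> (\<beta> - \<alpha>) 0) (view_vec \<theta> \<phi> (\<beta> - \<alpha>) 1) (view_vec \<theta> \<phi> (\<beta> - \<alpha>) 2) \<Longrightarrow>
        (cos k)\<^sup>2 < (sin \<phi>)\<^sup>2 * (sin (\<beta> - \<alpha>))\<^sup>2 * (1 + (sin k)\<^sup>2) \<or>
        (\<bar>sin \<phi> * sin (\<beta> - \<alpha>)\<bar> < sin k \<and> (\<bar>sin (\<theta> + c)\<bar> \<le> sin k \<or> \<bar>cos (\<theta> + c)\<bar> \<le> sin k))"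
        using dominated_imp[of k \<phi> "\<beta> - \<alpha>"] k by auto
      then show ?thesis using that[of c] by (auto simp: rel_dominated_def)
    qed
    have abs: "\<bar>sin (\<alpha> + (- \<beta>))\<bar> = \<bar>sin (\<beta> - \<alpha>)\<bar>"
      using sin_minus[of "\<beta> - \<alpha>"] by simp
    show "emeasure lborel ?A \<le> ?I"
    proof (cases "\<alpha> \<in> {0..2*pi}")
      case False
      then have "?A = {}" by (auto simp: rel_dominated_def)
      then show ?thesis by simp
    next
      case \<alpha>: True
      have A: "?A \<subseteq> {0..pi/2}" by (auto simp: rel_dominated_def)
      show ?thesis
      proof (cases "(cos k)\<^sup>2 < (sin \<phi>)\<^sup>2 * (sin (\<beta> - \<alpha>))\<^sup>2 * (1 + (sin k)\<^sup>2)")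
        case True
        have "(sin \<phi>)\<^sup>2 * (1 + (sin k)\<^sup>2) * (sin x)\<^sup>2 < (sin \<phi>)\<^sup>2 * (1 + (sin k)\<^sup>2) * (sin (\<beta> - \<alpha>))\<^sup>2"
          using xx True by (simp add: ac_simps)
        then have "(sin x)\<^sup>2 < (sin (\<beta> - \<alpha>))\<^sup>2"
          by (rule mult_left_less_imp_less) simp
        then have "\<bar>sin x\<bar> < \<bar>sin (\<beta> - \<alpha>)\<bar>"
          by (simp add: power2_less_imp_less abs_le_square_iff flip: not_le)
        then have "\<alpha> \<in> S2" using \<alpha> by (simp add: S2_def abs del: add_uminus_conv_diff)
        have "emeasure lborel ?A \<le> emeasure lborel {0..pi/2}" using A by (intro emeasure_mono) auto
        also have "\<dots> = ennreal (pi/2)" by simp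
        also have "\<dots> \<le> ?I" using \<open>\<alpha> \<in> S2\<close> by simp
        finally show ?thesis .
      next
        case False
        show ?thesis
        proof (cases "\<bar>sin \<phi> * sin (\<beta> - \<alpha>)\<bar> < sin k")
          case True
          have "\<bar>sin (\<beta> - \<alpha>)\<bar> \<le> sin h"
            using hh
          proof
            assume "h = pi/2"
            then show ?thesis by (simp only: sin_pi_half abs_sin_le_one)
          next
            assume "sin k \<le> \<bar>sin \<phi>\<bar> * sin h"
            with True have "\<bar>sin \<phi>\<bar> * \<bar>sin (\<beta> - \<alpha>)\<bar> < \<bar>sin \<phi>\<bar> * sin h" by (simp add: abs_mult)
            then show ?thesis using mult_left_less_imp_less[of "\<bar>sin \<phi>\<bar>"] by fastforce
          qed
          then have "\<alpha> \<in> S1" using \<alpha> by (simp add: S1_def abs del: add_uminus_conv_diff)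
          have "?A \<subseteq> {t \<in> {0..pi/2}. \<bar>sin (t + c)\<bar> \<le> sin k \<or> \<bar>cos (t + c)\<bar> \<le> sin k}"
            using c False A by blast
          then have "emeasure lborel ?A \<le> emeasure lborel {t \<in> {0..pi/2}. \<bar>sin (t + c)\<bar> \<le> sin k \<or> \<bar>cos (t + c)\<bar> \<le> sin k}"
            by (rule emeasure_mono) measurable
          also have "\<dots> \<le> ennreal (2 * k)" using k by (intro emeasure_near_axis) auto
          also have "\<dots> \<le> ?I" using \<open>\<alpha> \<in> S1\<close> by simp
          finally show ?thesis .
        next
          case nk: False
          have "?A = {}" using c False nk by blast
          then show ?thesis by simp
        qed
      qed
    qed
  qed
  also have "\<dots> = ennreal (2 * k) * emeasure lborel S1 + ennreal (pi/2) * emeasure lborel S2"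
    by (subst nn_integral_add) (auto simp: nn_integral_cmult_indicator)
  also have "\<dots> \<le> ennreal (2 * k) * ennreal (4 * (h - 0)) + ennreal (pi/2) * ennreal (4 * (pi/2 - x))"
    unfolding S1_def S2_def using h x by (intro add_mono mult_left_mono emeasure_abs_sin_band) auto
  also have "\<dots> = ennreal (2 * k * (4 * (h - 0)) + pi/2 * (4 * (pi/2 - x)))"
    using k h x by (subst (1 2) ennreal_mult[symmetric]) (auto intro!: ennreal_plus[symmetric])
  also have "2 * k * (4 * (h - 0)) + pi/2 * (4 * (pi/2 - x)) = 8 * h * k + 2 * pi * (pi/2 - x)"
    by simp
  finally show ?thesis .
qed

definition deg :: "nat \<Rightarrow> real" where "deg n = real n * (pi / 180)"

lemma deg_simps: "deg 0 = 0" "deg 90 = pi/2" "0 \<le> deg n"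
  by (simp_all add: deg_def)

lemma deg_le_iff [simp]: "deg m \<le> deg n \<longleftrightarrow> m \<le> n"
  by (simp add: deg_def)

lemma deg_le: "n \<le> 90 \<Longrightarrow> deg n \<le> pi/2"
  by (simp flip: deg_simps(2))

lemma deg_cell:
  assumes "0 \<le> x" "x \<le> pi/2"
  obtains i where "i < 90" "deg i \<le> x" "x \<le> deg (Suc i)"
proof (cases "x = pi/2")
  case True
  have "deg 89 \<le> x" "x \<le> deg (Suc 89)" unfolding True deg_def by simp_all
  then show ?thesis using that[of 89] by simp
next
  case False
  define i where "i = nat \<lfloor>x / (pi / 180)\<rfloor>"
  have "real i \<le> x / (pi / 180)" "x / (pi / 180) < real i + 1"
    using assms unfolding i_def by (simp_all add: of_nat_nat divide_nonneg_nonneg)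
  then have i: "deg i \<le> x" "x \<le> deg (Suc i)"
    by (simp_all add: deg_def field_simps)
  have "deg i < deg 90" using i(1) assms False unfolding deg_simps by simp
  then have "i < 90" by (simp add: deg_def)
  then show ?thesis using that i by blast
qed

lemma sin_deg_mono:
  "deg i \<le> x \<Longrightarrow> x \<le> pi/2 \<Longrightarrow> sin (deg i) \<le> sin x"
  "0 \<le> x \<Longrightarrow> x \<le> deg i \<Longrightarrow> i \<le> 90 \<Longrightarrow> sin x \<le> sin (deg i)"
  using sin_le_iff[of "deg i" x] sin_le_iff[of x "deg i"] deg_simps(3)[of i] deg_le[of i] by auto

lemma trig_deg_nonneg: "n \<le> 90 \<Longrightarrow> 0 \<le> sin (deg n)" "n \<le> 90 \<Longrightarrow> 0 \<le> cos (deg n)"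
  using deg_simps(3)[of n] deg_le[of n] pi_gt_zero by (auto intro!: sin_ge_zero cos_ge_zero)

text \<open>A column consists of one degree of \<phi> and its mirror image under \<phi> to pi -
  \<phi>, on which sin \<phi> takes the same values. The lateral condition is worst at the small end
  of sin \<phi>, the cap condition at the large end, hence \<open>deg i\<close> in \<open>H\<close>
  and \<open>deg (Suc i)\<close> in \<open>X\<close>. The sum counts cubes of side one
  degree.\<close>

lemma rel_dominated_total:
  fixes H X :: "nat \<Rightarrow> nat"
  assumes k: "0 < k" "k < 90"
    and H: "\<And>i. i < 90 \<Longrightarrow> H i = 90 \<or> H i < 90 \<and> sin (deg k) \<le> sin (deg i) * sin (deg (H i))"
    and X: "\<And>i. i < 90 \<Longrightarrow> X i \<le> 90 \<and>
        (sin (deg (Suc i)))\<^sup>2 * (sin (deg (X i)))\<^sup>2 * (1 + (sin (deg k))\<^sup>2) \<le> (cos (deg k))\<^sup>2"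
  shows "(\<integral>\<^sup>+\<phi>. emeasure lborel (rel_dominated (deg k) \<phi> \<beta>) * indicator {0..pi} \<phi> \<partial>lborel) \<le>
    ennreal (real (\<Sum>i<90. 16 * k * H i + 720 * (90 - X i)) * (pi / 180) ^ 3)"
proof -
  define C where "C i = {deg i..deg (Suc i)} \<union> {pi - deg (Suc i)..pi - deg i}" for i
  have kk: "0 < deg k" "deg k < pi/2" using k by (simp_all add: deg_def)
  have Hle: "H i \<le> 90" if "i < 90" for i using H[OF that] by auto
  have "(\<integral>\<^sup>+\<phi>. emeasure lborel (rel_dominated (deg k) \<phi> \<beta>) * indicator {0..pi} \<phi> \<partial>lborel) \<le>
    ennreal (2 * (pi / 180) * (\<Sum>i<90. 8 * deg (H i) * deg k + 2 * pi * (pi / 2 - deg (X i))))"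
  proof (rule nn_integral_cover_le[where C = C])
    show "{0..pi} \<subseteq> (\<Union>i<90. C i)"
    proof
      fix \<phi> :: real assume \<phi>: "\<phi> \<in> {0..pi}"
      then have m: "0 \<le> min \<phi> (pi - \<phi>)" "min \<phi> (pi - \<phi>) \<le> pi/2"
        by (auto simp: min_def)
      obtain i where i: "i < 90" "deg i \<le> min \<phi> (pi - \<phi>)" "min \<phi> (pi - \<phi>) \<le> deg (Suc i)"
        by (rule deg_cell[OF m])
      then have "\<phi> \<in> C i"
        by (auto simp: C_def min_def split: if_splits)
      with i(1) show "\<phi> \<in> (\<Union>i<90. C i)" by blast
    qed
    fix i :: nat assume i: "i < 90"
    show "C i \<in> sets lborel" by (simp add: C_def)
    have "emeasure lborel (C i) \<le> emeasure lborel {deg i..deg (Suc i)} + emeasure lborel {pi - deg (Suc i)..pi - deg i}"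
      unfolding C_def by (rule emeasure_subadditive) auto
    also have "\<dots> = ennreal (2 * (pi / 180))"
      by (subst (1 2) emeasure_lborel_Icc) (simp_all add: deg_def algebra_simps flip: ennreal_plus)
    finally show "emeasure lborel (C i) \<le> ennreal (2 * (pi / 180))" .
    show "0 \<le> 8 * deg (H i) * deg k + 2 * pi * (pi / 2 - deg (X i))"
      using X[OF i] deg_le[of "X i"] by (intro add_nonneg_nonneg mult_nonneg_nonneg) (auto simp: deg_simps)
    fix \<phi> assume \<phi>: "\<phi> \<in> {0..pi}" "\<phi> \<in> C i"
    have bounds: "sin (deg i) \<le> sin \<phi>" "sin \<phi> \<le> sin (deg (Suc i))"
    proof -
      define \<psi> where "\<psi> = (if \<phi> \<in> {deg i..deg (Suc i)} then \<phi> else pi - \<phi>)"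
      have "sin \<phi> = sin \<psi>" "deg i \<le> \<psi>" "\<psi> \<le> deg (Suc i)"
        using \<phi> by (auto simp: \<psi>_def C_def)
      moreover have "deg (Suc i) \<le> pi/2" using i by (intro deg_le) simp
      ultimately show "sin (deg i) \<le> sin \<phi>" "sin \<phi> \<le> sin (deg (Suc i))"
        using i deg_simps(3)[of i] by (auto intro: sin_deg_mono)
    qed
    have s0: "0 \<le> sin \<phi>" using \<phi> by (intro sin_ge_zero) auto
    show "emeasure lborel (rel_dominated (deg k) \<phi> \<beta>) \<le> ennreal (8 * deg (H i) * deg k + 2 * pi * (pi / 2 - deg (X i)))"
    proof (rule emeasure_rel_dominated[OF kk])
      show "0 \<le> deg (H i)" "deg (H i) \<le> pi/2" "0 \<le> deg (X i)" "deg (X i) \<le> pi/2"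
        using deg_le[OF Hle[OF i]] X[OF i] deg_le[of "X i"] by (simp_all add: deg_simps(3))
      show "deg (H i) = pi/2 \<or> sin (deg k) \<le> \<bar>sin \<phi>\<bar> * sin (deg (H i))"
      proof (cases "H i = 90")
        case False
        then have "sin (deg k) \<le> sin (deg i) * sin (deg (H i))" using H[OF i] by simp
        moreover have "0 \<le> sin (deg (H i))" by (rule trig_deg_nonneg(1)[OF Hle[OF i]])
        with bounds(1) have "sin (deg i) * sin (deg (H i)) \<le> sin \<phi> * sin (deg (H i))"
          by (rule mult_right_mono)
        ultimately show ?thesis using s0 by simp
      qed (simp add: deg_simps)
      have "(sin \<phi>)\<^sup>2 * (sin (deg (X i)))\<^sup>2 * (1 + (sin (deg k))\<^sup>2) \<le>
          (sin (deg (Suc i)))\<^sup>2 * (sin (deg (X i)))\<^sup>2 * (1 + (sin (deg k))\<^sup>2)"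
        using bounds(2) s0 by (intro mult_right_mono power_mono) auto
      also have "\<dots> \<le> (cos (deg k))\<^sup>2" using X[OF i] by simp
      finally show "(sin \<phi>)\<^sup>2 * (sin (deg (X i)))\<^sup>2 * (1 + (sin (deg k))\<^sup>2) \<le> (cos (deg k))\<^sup>2" .
    qed
  qed simp
  also have "2 * (pi / 180) * (\<Sum>i<90. 8 * deg (H i) * deg k + 2 * pi * (pi / 2 - deg (X i))) =
      real (\<Sum>i<90. 16 * k * H i + 720 * (90 - X i)) * (pi / 180) ^ 3"
    unfolding of_nat_sum sum_distrib_left sum_distrib_right
    using X by (intro sum.cong refl) (simp add: deg_def of_nat_diff power3_eq_cube field_simps)
  finally show ?thesis .
qed

text \<open>With \<open>v = (cos \<theta> * sin \<phi>, sin \<theta> * sin \<phi>, cos \<phi>)\<close> the view direction, these are the poses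
  in which no coordinate of \<open>v\<close> is less than \<open>tan k\<close> times the sum of the other two, in absolute value.\<close>

definition central_views :: "real \<Rightarrow> (real \<times> real) set" where
  "central_views k = {(\<theta>, \<phi>). \<theta> \<in> {0..pi/2} \<and> \<phi> \<in> {0..2*pi} \<and>
     tan k * (\<bar>cos \<theta> * sin \<phi>\<bar> + \<bar>sin \<theta> * sin \<phi>\<bar>) \<le> \<bar>cos \<phi>\<bar> \<and>
     tan k * (\<bar>sin \<theta> * sin \<phi>\<bar> + \<bar>cos \<phi>\<bar>) \<le> \<bar>cos \<theta> * sin \<phi>\<bar> \<and>
     tan k * (\<bar>cos \<theta> * sin \<phi>\<bar> + \<bar>cos \<phi>\<bar>) \<le> \<bar>sin \<theta> * sin \<phi>\<bar>}"

lemma central_views_measurable [measurable]: "central_views k \<in> sets borel"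
proof -
  have "central_views k = {p \<in> space (borel \<Otimes>\<^sub>M borel). fst p \<in> {0..pi/2} \<and> snd p \<in> {0..2*pi} \<and>
     tan k * (\<bar>cos (fst p) * sin (snd p)\<bar> + \<bar>sin (fst p) * sin (snd p)\<bar>) \<le> \<bar>cos (snd p)\<bar> \<and>
     tan k * (\<bar>sin (fst p) * sin (snd p)\<bar> + \<bar>cos (snd p)\<bar>) \<le> \<bar>cos (fst p) * sin (snd p)\<bar> \<and>
     tan k * (\<bar>cos (fst p) * sin (snd p)\<bar> + \<bar>cos (snd p)\<bar>) \<le> \<bar>sin (fst p) * sin (snd p)\<bar>}"
    by (auto simp: central_views_def space_pair_measure)
  also have "\<dots> \<in> sets (borel \<Otimes>\<^sub>M borel)"
    by measurable
  finally show ?thesis unfolding borel_prod .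
qed

text \<open>In a column of \<theta>, the first inequality of \<open>central_views\<close> bounds the
  absolute value of cos \<phi> from below, and either of the other two bounds it from above.
  Rewritten, those two carry cos (\<theta> + k) and sin (\<theta> - k), which gives the two
  alternatives for \<open>U\<close>. Both bounds use the worst end of the column.\<close>

lemma emeasure_central_views:
  fixes L U :: "nat \<Rightarrow> nat"
  assumes k: "0 < k" "k < 90"
    and L: "\<And>i. i < 90 \<Longrightarrow> L i \<le> 90 \<and>
      sin (deg (L i)) * cos (deg k) \<le> sin (deg k) * cos (deg (L i)) * (cos (deg (Suc i)) + sin (deg i))"
    and U: "\<And>i. i < 90 \<Longrightarrow> U i = 90 \<or> U i < 90 \<and>
      (cos (deg i + deg k) * cos (deg (U i)) \<le> sin (deg k) * sin (deg (U i)) \<or>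
       sin (deg (Suc i) - deg k) * cos (deg (U i)) \<le> sin (deg k) * sin (deg (U i)))"
  shows "emeasure lborel (central_views (deg k)) \<le> ennreal (real (\<Sum>i<90. 4 * (U i - L i)) * (pi / 180) ^ 2)"
proof -
  have kk: "0 < deg k" "deg k < pi/2" using k by (simp_all add: deg_def)
  have ck: "cos (deg k) > 0" and sk: "sin (deg k) > 0"
    using kk by (auto intro!: cos_gt_zero_pi sin_gt_zero)
  have Ule: "U i \<le> 90" if "i < 90" for i using U[OF that] by auto
  have "emeasure lborel (central_views (deg k)) = (\<integral>\<^sup>+\<theta>. emeasure lborel (Pair \<theta> -` central_views (deg k)) \<partial>lborel)"
    by (subst lborel_prod[symmetric], rule lborel.emeasure_pair_measure_alt)
      (simp only: lborel_prod sets_lborel central_views_measurable)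
  also have "\<dots> = (\<integral>\<^sup>+\<theta>. emeasure lborel (Pair \<theta> -` central_views (deg k)) * indicator {0..pi/2} \<theta> \<partial>lborel)"
    by (rule nn_integral_cong) (auto simp: central_views_def indicator_def vimage_def)
  also have "\<dots> \<le> ennreal (pi / 180 * (\<Sum>i<90. 4 * (real (U i - L i) * (pi / 180))))"
  proof (rule nn_integral_cover_le[where C = "\<lambda>i. {deg i..deg (Suc i)}"])
    show "{0..pi/2} \<subseteq> (\<Union>i<90. {deg i..deg (Suc i)})"
      by (auto elim!: deg_cell)
    fix i :: nat assume i: "i < 90"
    show "emeasure lborel {deg i..deg (Suc i)} \<le> ennreal (pi / 180)"
      by (subst emeasure_lborel_Icc) (simp_all add: deg_def algebra_simps)
    fix \<theta> assume \<theta>: "\<theta> \<in> {0..pi/2}" "\<theta> \<in> {deg i..deg (Suc i)}"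
    have c0: "cos \<theta> \<ge> 0" "sin \<theta> \<ge> 0" using \<theta> by (auto intro!: cos_ge_zero sin_ge_zero)
    \<comment> \<open>The cosine is written as a shifted sine so that the estimate for sine bands
      applies.\<close>
    let ?S = "{t \<in> {0..2*pi}. sin (deg (L i)) \<le> \<bar>sin (t + pi/2)\<bar> \<and> \<bar>sin (t + pi/2)\<bar> \<le> sin (deg (U i))}"
    have sub: "Pair \<theta> -` central_views (deg k) \<subseteq> ?S"
    proof
      fix \<phi> assume "\<phi> \<in> Pair \<theta> -` central_views (deg k)"
      define S C where "S = \<bar>sin \<phi>\<bar>" and "C = \<bar>cos \<phi>\<bar>"
      have SC: "0 \<le> S" "0 \<le> C" "S\<^sup>2 + C\<^sup>2 = 1" by (simp_all add: S_def C_def)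
      have mem: "\<phi> \<in> {0..2*pi}" "tan (deg k) * (cos \<theta> * S + sin \<theta> * S) \<le> C"
        "tan (deg k) * (sin \<theta> * S + C) \<le> cos \<theta> * S" "tan (deg k) * (cos \<theta> * S + C) \<le> sin \<theta> * S"
        using \<open>\<phi> \<in> Pair \<theta> -` central_views (deg k)\<close> c0
        by (auto simp: central_views_def S_def C_def abs_mult)
      have 1: "sin (deg k) * (S * (cos \<theta> + sin \<theta>)) \<le> C * cos (deg k)"
        using mem(2) ck by (simp add: tan_def field_simps)
      have 2: "sin (deg k) * C \<le> S * cos (\<theta> + deg k)"
        using mem(3) ck by (simp add: tan_def field_simps cos_add)
      have 3: "sin (deg k) * C \<le> S * sin (\<theta> - deg k)"
        using mem(4) ck by (simp add: tan_def field_simps sin_diff)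
      have compl: "S \<le> cos x" if "sin x \<le> C" "0 \<le> x" "x \<le> pi/2" for x
      proof -
        have "(sin x)\<^sup>2 \<le> C\<^sup>2" using that by (intro power_mono sin_ge_zero) auto
        then have "S\<^sup>2 \<le> (cos x)\<^sup>2" using SC(3) cos_squared_eq[of x] by linarith
        moreover have "0 \<le> cos x" using that by (intro cos_ge_zero) auto
        ultimately show ?thesis by (rule power2_le_imp_le)
      qed
      have compl': "cos x \<le> S" if "C \<le> sin x" "0 \<le> x" "x \<le> pi/2" for x
      proof -
        have "C\<^sup>2 \<le> (sin x)\<^sup>2" using that SC by (intro power_mono) auto
        then have "(cos x)\<^sup>2 \<le> S\<^sup>2" using SC(3) cos_squared_eq[of x] by linarith
        then show ?thesis using SC(1) by (rule power2_le_imp_le)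
      qed
      have low: "sin (deg (L i)) \<le> C"
      proof (rule ccontr)
        assume "\<not> ?thesis"
        then have CL: "C < sin (deg (L i))" by simp
        have Li: "0 \<le> deg (L i)" "deg (L i) \<le> pi/2" using L[OF i] deg_le[of "L i"] by (simp_all add: deg_simps(3))
        have "cos (deg (L i)) \<le> S" using CL Li by (intro compl') auto
        have "cos (deg (Suc i)) \<le> cos \<theta>" "sin (deg i) \<le> sin \<theta>"
          using \<theta> i deg_le[of "Suc i"] deg_simps(3)[of i] by (auto intro!: cos_monotone_0_pi_le sin_deg_mono)
        then have "cos (deg (L i)) * (cos (deg (Suc i)) + sin (deg i)) \<le> S * (cos \<theta> + sin \<theta>)"
          using \<open>cos (deg (L i)) \<le> S\<close> SC(1) i
          by (intro mult_mono add_mono add_nonneg_nonneg trig_deg_nonneg) auto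
        then have "sin (deg k) * (cos (deg (L i)) * (cos (deg (Suc i)) + sin (deg i))) \<le> C * cos (deg k)"
          using 1 sk by (meson mult_left_mono order_trans less_imp_le)
        moreover have "C * cos (deg k) < sin (deg (L i)) * cos (deg k)" using CL ck by simp
        ultimately show False using L[OF i] by (simp add: ac_simps)
      qed
      have up: "C \<le> sin (deg (U i))"
      proof (cases "U i = 90")
        case True
        then show ?thesis by (simp add: deg_simps C_def)
      next
        case False
        have Ui: "0 \<le> deg (U i)" "deg (U i) \<le> pi/2" using deg_le[OF Ule[OF i]] by (simp_all add: deg_simps(3))
        show ?thesis
        proof (rule ccontr)
          assume "\<not> ?thesis"
          then have CU: "sin (deg (U i)) < C" by simp
          then have SU: "S \<le> cos (deg (U i))" using Ui by (intro compl) auto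
          have C0: "0 < C" using CU Ui sin_ge_zero[of "deg (U i)"] by auto
          have contra: False if w: "sin (deg k) * C \<le> S * w" "w \<le> u" "u * cos (deg (U i)) \<le> sin (deg k) * sin (deg (U i))" for u w
          proof -
            have "0 < S * w" using w(1) sk C0 by (meson less_le_trans mult_pos_pos)
            then have "0 < w" using SC(1) by (auto simp: zero_less_mult_iff)
            then have "0 < u" using w(2) by simp
            have "sin (deg k) * C \<le> S * u" using w SC by (meson mult_left_mono order_trans)
            also have "\<dots> \<le> cos (deg (U i)) * u" using SU \<open>0 < u\<close> by (intro mult_right_mono) auto
            also have "\<dots> \<le> sin (deg k) * sin (deg (U i))" using w(3) by (simp add: mult.commute)
            finally show False using CU sk by simp
          qed
          have "cos (\<theta> + deg k) \<le> cos (deg i + deg k)"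
            using \<theta> kk deg_simps(3)[of i] by (intro cos_monotone_0_pi_le) auto
          moreover have "sin (\<theta> - deg k) \<le> sin (deg (Suc i) - deg k)"
            using \<theta> kk i deg_le[of "Suc i"] by (intro sin_monotone_2pi_le) auto
          ultimately show False using U[OF i] False contra[OF 2] contra[OF 3] by blast
        qed
      qed
      show "\<phi> \<in> ?S" using mem(1) low up by (simp add: sin_add C_def)
    qed
    have "emeasure lborel (Pair \<theta> -` central_views (deg k)) \<le> emeasure lborel ?S"
      using sub by (rule emeasure_mono) measurable
    also have "\<dots> \<le> ennreal (4 * (real (U i - L i) * (pi / 180)))"
    proof (cases "L i \<le> U i")
      case True
      then have "emeasure lborel ?S \<le> ennreal (4 * (deg (U i) - deg (L i)))"
        using deg_le[OF Ule[OF i]] by (intro emeasure_abs_sin_band) (simp_all add: deg_simps(3))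
      moreover have "4 * (deg (U i) - deg (L i)) = 4 * (real (U i - L i) * (pi / 180))"
        using True by (simp add: deg_def of_nat_diff field_simps)
      ultimately show ?thesis by metis
    next
      \<comment> \<open>The truncated difference \<open>U i - L i\<close> is then 0, which is
        correct because the two bounds contradict each other and the column is empty.\<close>
      case False
      then have "sin (deg (U i)) < sin (deg (L i))"
        using L[OF i] deg_simps(3)[of "U i"] deg_le[of "L i"] pi_gt_zero
        by (intro sin_monotone_2pi) (linarith | simp add: deg_def)+
      then have "?S = {}" by force
      then show ?thesis by (metis emeasure_empty zero_le)
    qed
    finally show "emeasure lborel (Pair \<theta> -` central_views (deg k)) \<le> ennreal (4 * (real (U i - L i) * (pi / 180)))" .
  qed auto
  also have "pi / 180 * (\<Sum>i<90. 4 * (real (U i - L i) * (pi / 180))) = real (\<Sum>i<90. 4 * (U i - L i)) * (pi / 180) ^ 2"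
    unfolding of_nat_sum sum_distrib_left sum_distrib_right
    by (intro sum.cong refl) (simp add: power2_eq_square)
  finally show ?thesis .
qed

section \<open>Sines of whole degrees\<close>

text \<open>The sine comes from its Taylor polynomial x - x^3/6 with remainder x^5/120, the cosine
  from the Pythagorean identity. Everything is in units of 10^-10.\<close>

lemma sin_deg1: "174524064 \<le> 10^10 * sin (deg 1)" "10^10 * sin (deg 1) \<le> 174524065"
  and cos_deg1: "9998476951 \<le> 10^10 * cos (deg 1)" "10^10 * cos (deg 1) \<le> 9998476952"
proof -
  define x where "x = deg 1"
  have x: "0.0174532925199 \<le> x" "x \<le> 0.0174532925200"
    using pi_approx by (simp_all add: x_def deg_def)
  have "\<bar>sin x - (x - x ^ 3 / 6)\<bar> \<le> \<bar>x\<bar> ^ 5 / 120"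
  proof -
    have "{..<5::nat} = {0, 1, 2, 3, 4}" by auto
    then have "(\<Sum>m<5. sin_coeff m * x ^ m) = x - x ^ 3 / 6"
      by (simp add: sin_coeff_def fact_numeral)
    then show ?thesis using Maclaurin_sin_bound[of x 5] by (simp add: fact_numeral)
  qed
  then have e: "sin x - (x - x ^ 3 / 6) \<le> x ^ 5 / 120" "- (x ^ 5 / 120) \<le> sin x - (x - x ^ 3 / 6)"
    using x unfolding abs_of_nonneg[OF order_trans[OF _ x(1), simplified]] by linarith+
  have "x ^ 5 \<le> 0.01745329252 ^ 5" "x ^ 3 \<le> 0.01745329252 ^ 3"
    "0.0174532925199 ^ 3 \<le> x ^ 3" using x by (intro power_mono; simp)+
  moreover have "(0.01745329252 :: real) ^ 5 \<le> 0.00000000163" "(0.01745329252 :: real) ^ 3 \<le> 0.000005316577"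
    "(0.000005316576 :: real) \<le> 0.0174532925199 ^ 3" by (simp_all add: power_divide)
  ultimately have "x ^ 5 \<le> 0.00000000163" "x ^ 3 \<le> 0.000005316577" "0.000005316576 \<le> x ^ 3"
    by linarith+
  then have s: "174524064 \<le> 10^10 * sin x" "10^10 * sin x \<le> 174524065"
    using x e by simp_all
  have c0: "0 \<le> cos x" using x pi_gt3 by (intro cos_ge_zero) auto
  have "(174524064 / 10^10)\<^sup>2 \<le> (sin x)\<^sup>2" "(sin x)\<^sup>2 \<le> (174524065 / 10^10)\<^sup>2"
    using s by (intro power_mono; simp)+
  then have "(9998476951 / 10^10)\<^sup>2 \<le> (cos x)\<^sup>2" "(cos x)\<^sup>2 \<le> (9998476952 / 10^10)\<^sup>2"
    unfolding cos_squared_eq by (simp_all add: power2_eq_square)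
  then have "9998476951 / 10^10 \<le> cos x" "cos x \<le> 9998476952 / 10^10"
    using c0 by (auto elim: power2_le_imp_le)
  then show "174524064 \<le> 10^10 * sin (deg 1)" "10^10 * sin (deg 1) \<le> 174524065"
    "9998476951 \<le> 10^10 * cos (deg 1)" "10^10 * cos (deg 1) \<le> 9998476952"
    using s by (simp_all add: x_def)
qed

text \<open>The addition formulas for a step of one degree in fixed-point interval arithmetic:
  \<open>div\<close> rounds lower bounds down, \<open>+ 1\<close> rounds upper bounds up. Clipping
  the lower cosine bound at 0 preserves the sign condition in \<open>encloses\<close>, which lets
  endpoints be multiplied monotonically.\<close>

fun rotate_bounds :: "int \<times> int \<times> int \<times> int \<Rightarrow> int \<times> int \<times> int \<times> int" where
  "rotate_bounds (sl, su, cl, cu) =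
    ((sl * 9998476951 + cl * 174524064) div 10000000000,
     (su * 9998476952 + cu * 174524065) div 10000000000 + 1,
     max 0 ((cl * 9998476951 - su * 174524065) div 10000000000),
     (cu * 9998476952 - sl * 174524064) div 10000000000 + 1)"

fun encloses :: "int \<times> int \<times> int \<times> int \<Rightarrow> real \<Rightarrow> bool" where
  "encloses (sl, su, cl, cu) x \<longleftrightarrow> 0 \<le> sl \<and> 0 \<le> cl \<and>
     sl \<le> 10^10 * sin x \<and> 10^10 * sin x \<le> su \<and> cl \<le> 10^10 * cos x \<and> 10^10 * cos x \<le> cu"

lemma div_bounds:
  fixes a :: int
  shows "real_of_int a \<le> 10^10 * r \<Longrightarrow> real_of_int (a div 10000000000) \<le> r"
    and "10^10 * r \<le> real_of_int a \<Longrightarrow> r \<le> real_of_int (a div 10000000000 + 1)"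
proof -
  have "a div 10000000000 = \<lfloor>real_of_int a / 10000000000\<rfloor>"
    using floor_divide_of_int_eq[of a 10000000000, where ?'a = real] by simp
  then have "real_of_int (a div 10000000000) \<le> real_of_int a / 10000000000"
    "real_of_int a / 10000000000 \<le> real_of_int (a div 10000000000 + 1)" by linarith+
  then show "real_of_int a \<le> 10^10 * r \<Longrightarrow> real_of_int (a div 10000000000) \<le> r"
    "10^10 * r \<le> real_of_int a \<Longrightarrow> r \<le> real_of_int (a div 10000000000 + 1)" by simp_all
qed

lemma encloses_rotate:
  assumes "encloses b (deg n)" "n < 90"
  shows "encloses (rotate_bounds b) (deg (Suc n))"
proof -
  obtain sl su cl cu where b: "b = (sl, su, cl, cu)" by (cases b)
  define S C s c where "S = 10^10 * sin (deg n)" and "C = 10^10 * cos (deg n)"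
    and "s = 10^10 * sin (deg 1)" and "c = 10^10 * cos (deg 1)"
  have e: "0 \<le> sl" "0 \<le> cl" "sl \<le> S" "S \<le> su" "cl \<le> C" "C \<le> cu"
    using assms(1) by (simp_all add: b S_def C_def)
  have pos: "0 \<le> S" "0 \<le> C" using assms(2) by (simp_all add: S_def C_def trig_deg_nonneg)
  have sc: "174524064 \<le> s" "s \<le> 174524065" "9998476951 \<le> c" "c \<le> 9998476952"
    using sin_deg1 cos_deg1 by (simp_all add: s_def c_def)
  have deg: "deg (Suc n) = deg n + deg 1" by (simp add: deg_def algebra_simps)
  have eq: "S * c + C * s = 10^10 * (10^10 * sin (deg (Suc n)))" "C * c - S * s = 10^10 * (10^10 * cos (deg (Suc n)))"
    unfolding deg by (simp_all add: S_def C_def s_def c_def sin_add cos_add algebra_simps)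
  have m: "real_of_int sl * 9998476951 \<le> S * c" "real_of_int cl * 174524064 \<le> C * s" "S * c \<le> real_of_int su * 9998476952" "C * s \<le> real_of_int cu * 174524065"
    "real_of_int cl * 9998476951 \<le> C * c" "S * s \<le> real_of_int su * 174524065" "C * c \<le> real_of_int cu * 9998476952" "real_of_int sl * 174524064 \<le> S * s"
    using e pos sc by (intro mult_mono; simp)+
  have h: "real_of_int (sl * 9998476951 + cl * 174524064) \<le> 10^10 * (10^10 * sin (deg (Suc n)))"
    "10^10 * (10^10 * sin (deg (Suc n))) \<le> real_of_int (su * 9998476952 + cu * 174524065)"
    "real_of_int (cl * 9998476951 - su * 174524065) \<le> 10^10 * (10^10 * cos (deg (Suc n)))"
    "10^10 * (10^10 * cos (deg (Suc n))) \<le> real_of_int (cu * 9998476952 - sl * 174524064)"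
    unfolding eq[symmetric] using m by simp_all
  note div_bounds(1)[OF h(1)] div_bounds(2)[OF h(2)] div_bounds(1)[OF h(3)] div_bounds(2)[OF h(4)]
  moreover have "0 \<le> cos (deg (Suc n))" using assms(2) by (intro trig_deg_nonneg) simp
  ultimately show ?thesis
    using e unfolding b by (simp add: pos_imp_zdiv_nonneg_iff)
qed

primrec sin_enclosures :: "nat \<Rightarrow> int \<times> int \<times> int \<times> int \<Rightarrow> (int \<times> int) list" where
  "sin_enclosures 0 b = []"
| "sin_enclosures (Suc n) b = (fst b, fst (snd b)) # sin_enclosures n (rotate_bounds b)"

lemma sin_enclosures:
  assumes "encloses b (deg m)" "m + n \<le> 91" "j < n"
  shows "fst (sin_enclosures n b ! j) \<le> 10^10 * sin (deg (m + j)) \<and>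
    10^10 * sin (deg (m + j)) \<le> snd (sin_enclosures n b ! j)"
  using assms
proof (induction n arbitrary: b m j)
  case (Suc n)
  show ?case
  proof (cases j)
    case 0
    then show ?thesis using Suc.prems(1) by (cases b) simp
  next
    case (Suc j')
    then have "encloses (rotate_bounds b) (deg (Suc m))"
      using Suc.prems by (intro encloses_rotate) auto
    from Suc.IH[OF this, of j'] show ?thesis using Suc Suc.prems by simp
  qed
qed simp

lemma length_sin_enclosures [simp]: "length (sin_enclosures n b) = n"
  by (induction n arbitrary: b) simp_all

text \<open>Sines of 0 to 90 degrees in units of 10^-5. The check below allows an error of one unit
  either way; with these short integers the later certificates stay cheap to evaluate.\<close>

definition sin_table :: "int list" where
  "sin_table = [0, 1745, 3490, 5234, 6976, 8716, 10453, 12187, 13917, 15643, 17365, 19081, 20791, 22495, 24192, 25882, 27564, 29237, 30902, 32557, 34202, 35837, 37461, 39073, 40674, 42262, 43837, 45399, 46947, 48481, 50000, 51504, 52992, 54464, 55919, 57358, 58779, 60182, 61566, 62932, 64279, 65606, 66913, 68200, 69466, 70711, 71934, 73135, 74314, 75471, 76604, 77715, 78801, 79864, 80902, 81915, 82904, 83867, 84805, 85717, 86603, 87462, 88295, 89101, 89879, 90631, 91355, 92050, 92718, 93358, 93969, 94552, 95106, 95630, 96126, 96593, 97030, 97437, 97815, 98163, 98481, 98769, 99027, 99255, 99452, 99619, 99756, 99863, 99939, 99985, 100000]"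

lemma sin_table_check:
  "list_all2 (\<lambda>(l, u) t. 100000 * (t - 1) \<le> l \<and> u \<le> 100000 * (t + 1))
     (sin_enclosures 91 (0, 0, 10000000000, 10000000000)) sin_table"
  by code_simp

definition sn :: "nat \<Rightarrow> int" where "sn n = sin_table ! n"

lemma sn_bounds:
  assumes "n \<le> 90"
  shows "real_of_int (sn n) - 1 \<le> 100000 * sin (deg n)" "100000 * sin (deg n) \<le> real_of_int (sn n) + 1"
proof -
  let ?b = "sin_enclosures 91 (0, 0, 10000000000, 10000000000) ! n"
  have "encloses (0, 0, 10000000000, 10000000000) (deg 0)" by (simp add: deg_simps)
  from sin_enclosures[OF this, of 91 n] assms
  have *: "fst ?b \<le> 10^10 * sin (deg n)" "10^10 * sin (deg n) \<le> snd ?b" by simp_all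
  have "100000 * (sn n - 1) \<le> fst ?b \<and> snd ?b \<le> 100000 * (sn n + 1)"
    using list_all2_nthD[OF sin_table_check, of n] assms by (simp add: sn_def split_beta)
  then have "real_of_int (100000 * (sn n - 1)) \<le> fst ?b" "snd ?b \<le> real_of_int (100000 * (sn n + 1))"
    by (simp_all only: of_int_le_iff)
  with * show "real_of_int (sn n) - 1 \<le> 100000 * sin (deg n)" "100000 * sin (deg n) \<le> real_of_int (sn n) + 1"
    by simp_all
qed

section \<open>Numerical bounds\<close>

lemma cos_deg_eq: "n \<le> 90 \<Longrightarrow> cos (deg n) = sin (deg (90 - n))"
  by (simp add: cos_sin_eq deg_def of_nat_diff field_simps)

text \<open>The three predicates below certify a column of the region \<open>sin \<phi> * sin t < sin k\<close>, of the cap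
  around an axis (where \<open>y\<close> is counted down from 90), and of \<open>central_views\<close>. The heights passed to them later were found by an
  external search and are essentially the best ones allowed by the table.\<close>

definition hyp_ok :: "nat \<Rightarrow> nat \<Rightarrow> nat \<Rightarrow> bool" where
  "hyp_ok k i h \<longleftrightarrow> h = 90 \<or> (h < 90 \<and> 1 \<le> sn i \<and> 1 \<le> sn h \<and> (sn k + 1) * 100000 \<le> (sn i - 1) * (sn h - 1))"

definition cap_ok :: "int \<Rightarrow> nat \<Rightarrow> nat \<Rightarrow> bool" where
  "cap_ok z i y \<longleftrightarrow> y \<le> 90 \<and> (sn (Suc i) + 1) * (sn (90 - y) + 1) \<le> z * 100000"

text \<open>Certifies \<open>z\<close> / 10^5 as a lower approximation of cos k / sqrt (1 + (sin
  k)^2), the height at which the cap around the third axis begins. Computing it once per k leaves a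
  single product to compare in each column.\<close>

definition cap_bound_ok :: "nat \<Rightarrow> int \<Rightarrow> bool" where
  "cap_bound_ok k z \<longleftrightarrow> 1 \<le> sn (90 - k) \<and>
     z * z * (10000000000 + (sn k + 1) * (sn k + 1)) \<le> (sn (90 - k) - 1) * (sn (90 - k) - 1) * 10000000000"

lemma sin_mult_ge:
  assumes "a \<le> 90" "b \<le> 90" "1 \<le> sn a" "1 \<le> sn b"
  shows "real_of_int ((sn a - 1) * (sn b - 1)) \<le> 10000000000 * (sin (deg a) * sin (deg b))"
proof -
  have "real_of_int ((sn a - 1) * (sn b - 1)) = (real_of_int (sn a) - 1) * (real_of_int (sn b) - 1)" by simp
  also have "\<dots> \<le> (100000 * sin (deg a)) * (100000 * sin (deg b))"
    using assms by (intro mult_mono sn_bounds) (auto simp: trig_deg_nonneg)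
  finally show ?thesis by simp
qed

lemma sin_mult_le:
  assumes "a \<le> 90" "b \<le> 90"
  shows "10000000000 * (sin (deg a) * sin (deg b)) \<le> real_of_int ((sn a + 1) * (sn b + 1))"
proof -
  have nn: "0 \<le> sin (deg n)" "0 \<le> real_of_int (sn n) + 1" if "n \<le> 90" for n
    using trig_deg_nonneg(1)[OF that] sn_bounds(2)[OF that] by auto
  have "10000000000 * (sin (deg a) * sin (deg b)) = (100000 * sin (deg a)) * (100000 * sin (deg b))" by simp
  also have "\<dots> \<le> (real_of_int (sn a) + 1) * (real_of_int (sn b) + 1)"
    using assms nn by (intro mult_mono sn_bounds) auto
  also have "\<dots> = real_of_int ((sn a + 1) * (sn b + 1))" by simp
  finally show ?thesis .
qed

lemma hyp_okD:
  assumes "hyp_ok k i h" "k \<le> 90" "i < 90"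
  shows "h = 90 \<or> h < 90 \<and> sin (deg k) \<le> sin (deg i) * sin (deg h)"
proof (cases "h = 90")
  case False
  then have h: "h < 90" "1 \<le> sn i" "1 \<le> sn h" "(sn k + 1) * 100000 \<le> (sn i - 1) * (sn h - 1)"
    using assms by (auto simp: hyp_ok_def)
  have "100000 * (100000 * sin (deg k)) \<le> 100000 * (real_of_int (sn k) + 1)"
    using sn_bounds(2)[OF assms(2)] by simp
  also have "\<dots> = real_of_int ((sn k + 1) * 100000)" by simp
  also have "\<dots> \<le> real_of_int ((sn i - 1) * (sn h - 1))" using h(4) by (simp only: of_int_le_iff)
  also have "\<dots> \<le> 10000000000 * (sin (deg i) * sin (deg h))" using h assms by (intro sin_mult_ge) auto
  finally show ?thesis using h(1) by simp
qed simp

lemma cap_okD: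
  assumes "cap_ok z i y" "cap_bound_ok k z" "k \<le> 90" "i < 90"
  shows "90 - y \<le> 90 \<and>
    (sin (deg (Suc i)))\<^sup>2 * (sin (deg (90 - y)))\<^sup>2 * (1 + (sin (deg k))\<^sup>2) \<le> (cos (deg k))\<^sup>2"
proof -
  define p where "p = 100000 * (sin (deg (Suc i)) * sin (deg (90 - y)))"
  have p0: "0 \<le> p" using assms(4) by (auto simp: p_def trig_deg_nonneg)
  have "100000 * p \<le> real_of_int ((sn (Suc i) + 1) * (sn (90 - y) + 1))"
    using sin_mult_le[of "Suc i" "90 - y"] assms(4) by (simp add: p_def)
  also have "\<dots> \<le> real_of_int (z * 100000)" using assms(1) unfolding cap_ok_def by (simp only: of_int_le_iff)
  finally have pz: "p \<le> z" by simp
  have K: "(100000 * sin (deg k)) * (100000 * sin (deg k)) \<le> real_of_int ((sn k + 1) * (sn k + 1))"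
    using sin_mult_le[OF assms(3) assms(3)] by simp
  have "p * p * (10000000000 + (100000 * sin (deg k)) * (100000 * sin (deg k))) \<le>
      real_of_int z * real_of_int z * (10000000000 + real_of_int ((sn k + 1) * (sn k + 1)))"
    using p0 pz K by (intro mult_mono add_mono) auto
  also have "\<dots> = real_of_int (z * z * (10000000000 + (sn k + 1) * (sn k + 1)))" by simp
  also have "\<dots> \<le> real_of_int ((sn (90 - k) - 1) * (sn (90 - k) - 1) * 10000000000)"
    using assms(2) unfolding cap_bound_ok_def by (simp only: of_int_le_iff)
  also have "\<dots> = real_of_int ((sn (90 - k) - 1) * (sn (90 - k) - 1)) * 10000000000" by simp
  also have "\<dots> \<le> 10000000000 * (sin (deg (90 - k)) * sin (deg (90 - k))) * 10000000000"
    using assms(2) unfolding cap_bound_ok_def by (intro mult_right_mono sin_mult_ge) auto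
  finally show ?thesis
    unfolding cos_deg_eq[OF assms(3)] p_def by (simp add: power2_eq_square algebra_simps)
qed

lemma sum_nth_list: "length xs = n \<Longrightarrow> (\<Sum>i<n. f (xs ! i)) = sum_list (map f xs)"
  by (simp add: sum_list_sum_nth atLeast0LessThan)

lemma rel_dominated_check:
  assumes k: "0 < k" "k < 90" and "cap_bound_ok k z"
    and H: "list_all2 (hyp_ok k) [0..<90] hs" and Y: "list_all2 (cap_ok z) [0..<90] ys"
    and n: "16 * k * sum_list hs + 720 * sum_list ys = n"
  shows "(\<integral>\<^sup>+\<phi>. emeasure lborel (rel_dominated (deg k) \<phi> \<beta>) * indicator {0..pi} \<phi> \<partial>lborel) \<le>
    ennreal (real n * (pi / 180) ^ 3)"
proof -
  have len: "length hs = 90" "length ys = 90" using H Y by (auto dest: list_all2_lengthD)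
  have Hi: "hyp_ok k i (hs ! i)" and Yi: "cap_ok z i (ys ! i)" if "i < 90" for i
    using list_all2_nthD[OF H, of i] list_all2_nthD[OF Y, of i] that by simp_all
  have "(\<integral>\<^sup>+\<phi>. emeasure lborel (rel_dominated (deg k) \<phi> \<beta>) * indicator {0..pi} \<phi> \<partial>lborel) \<le>
    ennreal (real (\<Sum>i<90. 16 * k * hs ! i + 720 * (90 - (90 - ys ! i))) * (pi / 180) ^ 3)"
    using k Hi Yi assms(3) by (intro rel_dominated_total hyp_okD cap_okD) auto
  also have "(\<Sum>i<90. 16 * k * hs ! i + 720 * (90 - (90 - ys ! i))) = (\<Sum>i<90. 16 * k * hs ! i) + (\<Sum>i<90. 720 * ys ! i)"
    using Yi by (simp add: cap_ok_def flip: sum.distrib)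
  also have "\<dots> = n"
    using n sum_nth_list[OF len(1), of "\<lambda>h. h"] sum_nth_list[OF len(2), of "\<lambda>h. h"]
    by (simp flip: sum_distrib_left)
  finally show ?thesis .
qed

definition band_ok :: "nat \<Rightarrow> nat \<Rightarrow> nat \<times> nat \<Rightarrow> bool" where
  "band_ok k i p \<longleftrightarrow> (case p of (l, u) \<Rightarrow>
     (l = 0 \<or> l \<le> 90 \<and> 1 \<le> sn k \<and> 1 \<le> sn (90 - l) \<and> 2 \<le> sn (89 - i) + sn i \<and>
       (sn l + 1) * (sn (90 - k) + 1) * 100000 \<le> (sn k - 1) * (sn (90 - l) - 1) * (sn (89 - i) + sn i - 2)) \<and>
     (u = 90 \<or> u = 0 \<and> (90 \<le> i + k \<or> Suc i \<le> k) \<or>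
      u < 90 \<and> 1 \<le> sn k \<and> 1 \<le> sn u \<and>
       (i + k \<le> 90 \<and> (sn (90 - (i + k)) + 1) * (sn (90 - u) + 1) \<le> (sn k - 1) * (sn u - 1) \<or>
        k \<le> Suc i \<and> (sn (Suc i - k) + 1) * (sn (90 - u) + 1) \<le> (sn k - 1) * (sn u - 1))))"

lemma band_ok_lower:
  assumes "band_ok k i (l, u)" "k \<le> 90" "i < 90"
  shows "l \<le> 90 \<and> sin (deg l) * cos (deg k) \<le> sin (deg k) * cos (deg l) * (cos (deg (Suc i)) + sin (deg i))"
proof (cases "l = 0")
  case True
  then show ?thesis using assms by (auto simp: deg_simps(1) trig_deg_nonneg)
next
  case False
  then have l: "l \<le> 90" "1 \<le> sn k" "1 \<le> sn (90 - l)" "2 \<le> sn (89 - i) + sn i"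
     "(sn l + 1) * (sn (90 - k) + 1) * 100000 \<le> (sn k - 1) * (sn (90 - l) - 1) * (sn (89 - i) + sn i - 2)"
    using assms(1) by (simp_all add: band_ok_def)
  \<comment> \<open>Here 89 - i is 90 - (i + 1), so the first sine is the cosine at the right end of
    the column.\<close>
  have m: "real_of_int (sn (89 - i) + sn i - 2) \<le> 100000 * (sin (deg (89 - i)) + sin (deg i))"
    using sn_bounds(1)[of "89 - i"] sn_bounds(1)[of i] assms(3) by (auto simp: le_diff_conv)
  have "10000000000 * (sin (deg l) * sin (deg (90 - k))) * 100000 \<le> real_of_int ((sn l + 1) * (sn (90 - k) + 1)) * 100000"
    using l(1) by (intro mult_right_mono sin_mult_le) auto
  also have "\<dots> = real_of_int ((sn l + 1) * (sn (90 - k) + 1) * 100000)" by simp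
  also have "\<dots> \<le> real_of_int ((sn k - 1) * (sn (90 - l) - 1) * (sn (89 - i) + sn i - 2))"
    using l(5) by (simp only: of_int_le_iff)
  also have "\<dots> = real_of_int ((sn k - 1) * (sn (90 - l) - 1)) * real_of_int (sn (89 - i) + sn i - 2)" by simp
  also have "\<dots> \<le> (10000000000 * (sin (deg k) * sin (deg (90 - l)))) * (100000 * (sin (deg (89 - i)) + sin (deg i)))"
    using l assms m trig_deg_nonneg(1)[of k] trig_deg_nonneg(1)[of "90 - l"]
    by (intro mult_mono sin_mult_ge m) auto
  finally have "sin (deg l) * sin (deg (90 - k)) \<le> sin (deg k) * sin (deg (90 - l)) * (sin (deg (89 - i)) + sin (deg i))"
    by (simp add: algebra_simps)
  then show ?thesis using l(1) assms by (simp add: cos_deg_eq)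
qed

lemma band_ok_upper:
  assumes "band_ok k i (l, u)" "k \<le> 90" "i < 90"
  shows "u = 90 \<or> u < 90 \<and>
      (cos (deg i + deg k) * cos (deg u) \<le> sin (deg k) * sin (deg u) \<or>
       sin (deg (Suc i) - deg k) * cos (deg u) \<le> sin (deg k) * sin (deg u))"
proof -
  have small: "sin (deg a) * cos (deg u) \<le> sin (deg k) * sin (deg u)"
    if "u < 90" "1 \<le> sn k" "1 \<le> sn u" "a \<le> 90" "(sn a + 1) * (sn (90 - u) + 1) \<le> (sn k - 1) * (sn u - 1)" for a
  proof -
    have "10000000000 * (sin (deg a) * sin (deg (90 - u))) \<le> real_of_int ((sn a + 1) * (sn (90 - u) + 1))"
      using that by (intro sin_mult_le) auto
    also have "\<dots> \<le> real_of_int ((sn k - 1) * (sn u - 1))" using that(5) by (simp only: of_int_le_iff)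
    also have "\<dots> \<le> 10000000000 * (sin (deg k) * sin (deg u))" using that assms by (intro sin_mult_ge) auto
    finally show ?thesis using that by (simp add: cos_deg_eq)
  qed
  have add: "deg i + deg k = deg (i + k)" by (simp add: deg_def algebra_simps)
  \<comment> \<open>The value 90 claims nothing. The value 0 marks a column where cos (\<theta> + k)
    or sin (\<theta> - k) is nonpositive throughout.\<close>
  consider "u = 90" | "u = 0" "90 \<le> i + k" | "u = 0" "Suc i \<le> k"
    | "u < 90" "1 \<le> sn k" "1 \<le> sn u" "i + k \<le> 90" "(sn (90 - (i + k)) + 1) * (sn (90 - u) + 1) \<le> (sn k - 1) * (sn u - 1)"
    | "u < 90" "1 \<le> sn k" "1 \<le> sn u" "k \<le> Suc i" "(sn (Suc i - k) + 1) * (sn (90 - u) + 1) \<le> (sn k - 1) * (sn u - 1)"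
    using assms(1) unfolding band_ok_def by auto
  then show ?thesis
  proof cases
    case 2
    have "deg 90 \<le> deg (i + k)" "deg (i + k) \<le> deg 180" using 2(2) assms by (simp_all only: deg_le_iff)
    then have "pi/2 \<le> deg (i + k)" "deg (i + k) \<le> pi" by (simp_all add: deg_def)
    then have "cos (deg (i + k)) \<le> cos (pi/2)" by (intro cos_monotone_0_pi_le) auto
    then show ?thesis using 2(1) by (simp add: deg_simps(1) add)
  next
    case 3
    have "0 \<le> sin (deg k - deg (Suc i))"
      using deg_le_iff[of "Suc i" k] 3(2) deg_le[OF assms(2)] deg_simps(3)[of "Suc i"] pi_gt_zero
      by (intro sin_ge_zero) linarith+
    then have "sin (deg (Suc i) - deg k) \<le> 0" using sin_minus[of "deg k - deg (Suc i)"] by simp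
    then show ?thesis using 3(1) by (simp add: deg_simps(1))
  next
    case 4
    have "cos (deg i + deg k) = sin (deg (90 - (i + k)))" using 4(4) by (simp add: add cos_deg_eq)
    then show ?thesis using small[of "90 - (i + k)"] 4 by simp
  next
    case 5
    have "deg (Suc i) - deg k = deg (Suc i - k)" using 5(4) by (simp add: deg_def of_nat_diff algebra_simps)
    then show ?thesis using small[of "Suc i - k"] 5 assms(3) by simp
  qed simp
qed

lemma central_views_check:
  assumes k: "0 < k" "k < 90" and B: "list_all2 (band_ok k) [0..<90] bs"
    and n: "4 * sum_list (map (\<lambda>(l, u). u - l) bs) = n"
  shows "emeasure lborel (central_views (deg k)) \<le> ennreal (real n * (pi / 180) ^ 2)"
proof -
  have len: "length bs = 90" using B by (auto dest: list_all2_lengthD)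
  have Bi: "band_ok k i (fst (bs ! i), snd (bs ! i))" if "i < 90" for i
    using list_all2_nthD[OF B, of i] that by simp
  have "emeasure lborel (central_views (deg k)) \<le>
      ennreal (real (\<Sum>i<90. 4 * (snd (bs ! i) - fst (bs ! i))) * (pi / 180) ^ 2)"
    using k band_ok_lower[OF Bi] band_ok_upper[OF Bi] by (intro emeasure_central_views) auto
  also have "(\<Sum>i<90. 4 * (snd (bs ! i) - fst (bs ! i))) = n"
    using n sum_nth_list[OF len, of "\<lambda>(l, u). u - l"] by (simp add: split_beta flip: sum_distrib_left)
  finally show ?thesis .
qed

section \<open>Certificates for the chosen angles\<close>

text \<open>\<open>hs\<close> lists the angles \<open>h\<close> of the lateral region and
  \<open>ys\<close> the complements \<open>pi/2 - x\<close> of the cap angles, in degrees. The total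
  102832 is 16 * 4 times the sum of \<open>hs\<close> plus 720 times the sum of \<open>ys\<close>;
  the lemmas for the other angles have the same form.\<close>

lemma dominated_4: "(\<integral>\<^sup>+\<phi>. emeasure lborel (rel_dominated (deg 4) \<phi> \<beta>) * indicator {0..pi} \<phi> \<partial>lborel) \<le>
    ennreal (real 102832 * (pi / 180) ^ 3)"
  by (rule rel_dominated_check[where z = 99513 and
     hs = "[90, 90, 90, 90, 90, 54, 42, 35, 31, 27, 24, 22, 20, 19, 17, 16, 15, 14, 14, 13, 12, 12, 11,
     11, 10, 10, 10, 9, 9, 9, 9, 8, 8, 8, 8, 7, 7, 7, 7, 7, 7, 7] @ replicate 12 6 @ replicate 36 5" and
     ys = "replicate 84 0 @ [3, 5, 5, 6, 6, 6]"], simp, simp, code_simp, code_simp, code_simp, simp add: sum_list_replicate)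

lemma dominated_8: "(\<integral>\<^sup>+\<phi>. emeasure lborel (rel_dominated (deg 8) \<phi> \<beta>) * indicator {0..pi} \<phi> \<partial>lborel) \<le>
    ennreal (real 347904 * (pi / 180) ^ 3)"
  by (rule rel_dominated_check[where z = 98080 and
     hs = "replicate 9 90 @ [63, 54, 47, 43, 39, 36, 33, 31, 29, 27, 26, 25, 23, 22, 21, 21, 20, 19, 18,
     18, 17, 17, 16, 16, 15, 15, 15, 14, 14, 14, 13, 13, 13, 13, 12, 12, 12, 12, 11, 11, 11, 11, 11,
     11, 11] @ replicate 9 10 @ replicate 27 9" and
     ys = "replicate 78 0 @ [3, 6, 7, 8, 9, 10, 11, 11, 11, 12, 12, 12]"], simp, simp, code_simp, code_simp, code_simp, simp add: sum_list_replicate)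

lemma dominated_11: "(\<integral>\<^sup>+\<phi>. emeasure lborel (rel_dominated (deg 11) \<phi> \<beta>) * indicator {0..pi} \<phi> \<partial>lborel) \<le>
    ennreal (real 607984 * (pi / 180) ^ 3)"
  by (rule rel_dominated_check[where z = 96422 and
     hs = "replicate 12 90 @ [67, 59, 53, 48, 44, 41, 39, 36, 34, 33, 31, 30, 28, 27, 26, 25, 24, 24, 23,
     22, 22, 21, 20, 20, 19, 19, 19, 18, 18, 17, 17, 17, 16, 16, 16, 16, 15, 15, 15, 15, 15, 14, 14,
     14, 14, 14, 14] @ replicate 8 13 @ replicate 23 12" and
     ys = "replicate 74 0 @ [4, 7, 9, 10, 11, 12, 13, 14, 14, 15, 15, 15, 16, 16, 16, 16]"], simp, simp, code_simp, code_simp, code_simp, simp add: sum_list_replicate)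

lemma dominated_14: "(\<integral>\<^sup>+\<phi>. emeasure lborel (rel_dominated (deg 14) \<phi> \<beta>) * indicator {0..pi} \<phi> \<partial>lborel) \<le>
    ennreal (real 928384 * (pi / 180) ^ 3)"
  by (rule rel_dominated_check[where z = 94308 and
     hs = "replicate 15 90 @ [70, 62, 56, 52, 48, 46, 43, 41, 39, 37, 35, 34, 33, 32, 30, 29, 29, 28, 27,
     26, 25, 25, 24, 24, 23, 23, 22, 22, 21, 21, 21, 20, 20, 19, 19, 19, 19, 18, 18, 18, 18, 17, 17,
     17, 17, 17, 17] @ replicate 8 16 @ replicate 20 15" and
     ys = "replicate 70 0 @ [5, 8, 10, 12, 13, 14, 15, 16, 17, 17, 18, 18, 19, 19, 19, 20, 20, 20, 20, 20]"], simp, simp, code_simp, code_simp, code_simp, simp add: sum_list_replicate)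

lemma dominated_18: "(\<integral>\<^sup>+\<phi>. emeasure lborel (rel_dominated (deg 18) \<phi> \<beta>) * indicator {0..pi} \<phi> \<partial>lborel) \<le>
    ennreal (real 1432512 * (pi / 180) ^ 3)"
  by (rule rel_dominated_check[where z = 90865 and
     hs = "replicate 19 90 @ [72, 65, 60, 56, 53, 50, 47, 45, 43, 42, 40, 39, 37, 36, 35, 34, 33, 32, 31,
     31, 30, 29, 29, 28, 27, 27, 26, 26, 25, 25, 25, 24, 24, 24, 23, 23, 23, 22, 22, 22, 22, 21, 21,
     21, 21, 21, 20, 20, 20, 20, 20, 20, 20] @ replicate 18 19" and
     ys = "replicate 65 0 @ [6, 10, 12, 14, 15, 17, 18, 19, 20, 20, 21, 22, 22, 23, 23, 24, 24, 24, 24,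
     25, 25, 25, 25, 25, 25]"], simp, simp, code_simp, code_simp, code_simp, simp add: sum_list_replicate)

lemma dominated_22: "(\<integral>\<^sup>+\<phi>. emeasure lborel (rel_dominated (deg 22) \<phi> \<beta>) * indicator {0..pi} \<phi> \<partial>lborel) \<le>
    ennreal (real 2018080 * (pi / 180) ^ 3)"
  by (rule rel_dominated_check[where z = 86824 and
     hs = "replicate 23 90 @ [74, 68, 63, 59, 56, 53, 51, 49, 47, 45, 44, 43, 41, 40, 39, 38, 37, 36, 35,
     35, 34, 33, 32, 32, 31, 31, 30, 30, 29, 29, 28, 28, 28, 27, 27, 27, 26, 26, 26, 26, 25, 25, 25,
     25, 25, 24, 24, 24, 24, 24, 24] @ replicate 16 23" and
     ys = "replicate 60 0 @ [7, 11, 13, 15, 17, 19, 20, 21, 22, 23, 24, 25, 25, 26, 26, 27, 27, 28, 28,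
     29, 29, 29, 29, 30, 30, 30, 30, 30, 30, 30]"], simp, simp, code_simp, code_simp, code_simp, simp add: sum_list_replicate)

lemma dominated_30: "(\<integral>\<^sup>+\<phi>. emeasure lborel (rel_dominated (deg 30) \<phi> \<beta>) * indicator {0..pi} \<phi> \<partial>lborel) \<le>
    ennreal (real 3402480 * (pi / 180) ^ 3)"
  by (rule rel_dominated_check[where z = 77458 and
     hs = "replicate 31 90 @ [77, 71, 67, 64, 61, 59, 57, 55, 53, 52, 50, 49, 48, 47, 46, 45, 44, 43, 42,
     41, 41, 40, 39, 39, 38, 38, 37, 37, 36, 36, 35, 35, 35, 34, 34, 34, 33, 33, 33, 33, 32, 32, 32,
     32, 32, 32] @ replicate 13 31" and
     ys = "replicate 50 0 @ [5, 11, 15, 17, 19, 21, 23, 25, 26, 27, 28, 29, 30, 31, 32, 33, 33, 34, 34,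
     35, 35, 36, 36, 37, 37, 38, 38, 38, 38, 39, 39, 39, 39, 39, 39, 40, 40, 40, 40, 40]"], simp, simp, code_simp, code_simp, code_simp, simp add: sum_list_replicate)

text \<open>Exchanging the first two coordinates maps \<theta> to pi/2 - \<theta> and column i to
  column 89 - i, so 45 pairs are listed and then reversed. Pairs with equal entries contribute
  0.\<close>

lemma central_4: "emeasure lborel (central_views (deg 4)) \<le> ennreal (real 22288 * (pi / 180) ^ 2)"
  by (rule central_views_check[where bs = "let bs = replicate 4 (0, 0) @
     [(4, 15), (4, 27), (4, 37), (4, 46), (4, 52), (4, 57), (4, 61), (4, 64), (4, 66), (4, 69), (4,
     70), (4, 72), (4, 73), (4, 74), (5, 75), (5, 76), (5, 77), (5, 78), (5, 78), (5, 79), (5, 79),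
     (5, 80), (5, 80), (5, 81), (5, 81), (5, 81), (5, 82), (5, 82), (5, 82), (5, 83), (5, 83), (5,
     83), (5, 83), (5, 83), (5, 84), (5, 84), (5, 84), (5, 84), (5, 84), (5, 84), (5, 84)] in bs @ rev bs"], simp, simp, code_simp, simp add: Let_def sum_list_replicate)

lemma central_8: "emeasure lborel (central_views (deg 8)) \<le> ennreal (real 14752 * (pi / 180) ^ 2)"
  by (rule central_views_check[where bs = "let bs = replicate 8 (0, 0) @
     [(8, 8), (9, 15), (9, 21), (9, 27), (9, 33), (9, 37), (9, 42), (9, 46), (9, 49), (9, 52), (9,
     54), (10, 57), (10, 59), (10, 61), (10, 62), (10, 64), (10, 65), (10, 66), (10, 67), (10, 68),
     (10, 69), (10, 70), (10, 71), (10, 72), (10, 72), (10, 73), (10, 73), (10, 74), (11, 74), (11,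
     75), (11, 75), (11, 76), (11, 76), (11, 77), (11, 77), (11, 77), (11, 77)] in bs @ rev bs"], simp, simp, code_simp, simp add: Let_def sum_list_replicate)

lemma central_11: "emeasure lborel (central_views (deg 11)) \<le> ennreal (real 10272 * (pi / 180) ^ 2)"
  by (rule central_views_check[where bs = "let bs = replicate 11 (0, 0) @
     [(6, 6), (11, 11), (13, 16), (13, 21), (13, 25), (13, 29), (13, 33), (13, 37), (13, 40), (13,
     43), (14, 46), (14, 48), (14, 50), (14, 52), (14, 54), (14, 56), (14, 57), (14, 59), (14, 60),
     (14, 61), (14, 62), (14, 64), (14, 64), (14, 65), (15, 66), (15, 67), (15, 68), (15, 68), (15,
     69), (15, 70), (15, 70), (15, 71), (15, 71), (15, 72)] in bs @ rev bs"], simp, simp, code_simp, simp add: Let_def sum_list_replicate)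

lemma central_14: "emeasure lborel (central_views (deg 14)) \<le> ennreal (real 6648 * (pi / 180) ^ 2)"
  by (rule central_views_check[where bs = "let bs = replicate 14 (0, 0) @
     [(5, 5), (9, 9), (13, 13), (17, 17), (17, 20), (17, 24), (17, 27), (17, 30), (17, 33), (18,
     36), (18, 39), (18, 41), (18, 43), (18, 46), (18, 47), (18, 49), (18, 51), (18, 52), (18, 54),
     (18, 55), (18, 56), (19, 58), (19, 59), (19, 60), (19, 61), (19, 62), (19, 62), (19, 63), (19,
     64), (19, 65), (19, 65)] in bs @ rev bs"], simp, simp, code_simp, simp add: Let_def sum_list_replicate)

lemma central_18: "emeasure lborel (central_views (deg 18)) \<le> ennreal (real 3120 * (pi / 180) ^ 2)"
  by (rule central_views_check[where bs = "let bs = replicate 18 (0, 0) @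
     [(4, 4), (7, 7), (10, 10), (13, 13), (16, 16), (19, 19), (22, 22), (23, 25), (23, 27), (23,
     30), (23, 32), (23, 34), (23, 37), (23, 39), (23, 40), (24, 42), (24, 44), (24, 46), (24, 47),
     (24, 48), (24, 50), (24, 51), (24, 52), (24, 53), (24, 54), (24, 55), (24, 56)] in bs @ rev bs"], simp, simp, code_simp, simp add: Let_def sum_list_replicate)

lemma central_22: "emeasure lborel (central_views (deg 22)) \<le> ennreal (real 936 * (pi / 180) ^ 2)"
  by (rule central_views_check[where bs = "let bs = replicate 22 (0, 0) @
     [(3, 3), (6, 6), (8, 8), (11, 11), (14, 14), (16, 16), (19, 19), (21, 21), (23, 23), (25, 25),
     (27, 27), (29, 30), (29, 31), (29, 33), (29, 35), (29, 37), (29, 38), (29, 40), (29, 41), (29,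
     43), (29, 44), (29, 46), (29, 47)] in bs @ rev bs"], simp, simp, code_simp, simp add: Let_def sum_list_replicate)

section \<open>The certified set\<close>

lemma probe_direction_perm:
  fixes x y z \<rho> :: real
  assumes "\<bar>z\<bar> \<le> \<rho> * (\<bar>x\<bar> + \<bar>y\<bar>) \<or> \<bar>x\<bar> \<le> \<rho> * (\<bar>y\<bar> + \<bar>z\<bar>) \<or> \<bar>y\<bar> \<le> \<rho> * (\<bar>x\<bar> + \<bar>z\<bar>)"
    and unit: "x\<^sup>2 + y\<^sup>2 + z\<^sup>2 = 1" and \<rho>: "0 \<le> \<rho>" "\<rho> \<le> 1/2"
  obtains a b c where "a\<^sup>2 + b\<^sup>2 + c\<^sup>2 = 1" "x * a + y * b + z * c = 0"
    "\<rho> \<le> 9/22 \<Longrightarrow> (width_norm a b c)\<^sup>2 * (1 + 2 * \<rho>\<^sup>2) \<le> 4 * (1 + \<rho>)\<^sup>2"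
    "(width_norm a b c)\<^sup>2 \<le> 961/150"
proof -
  consider "\<bar>z\<bar> \<le> \<rho> * (\<bar>x\<bar> + \<bar>y\<bar>)" | "\<bar>x\<bar> \<le> \<rho> * (\<bar>y\<bar> + \<bar>z\<bar>)" | "\<bar>y\<bar> \<le> \<rho> * (\<bar>x\<bar> + \<bar>z\<bar>)"
    using assms(1) by blast
  then show ?thesis
  proof cases
    case 1
    then show ?thesis using probe_direction[OF _ unit \<rho>] that by metis
  next
    case 2
    have "y\<^sup>2 + z\<^sup>2 + x\<^sup>2 = 1" using unit by simp
    from probe_direction[OF 2 this \<rho>] obtain b c a where n: "b\<^sup>2 + c\<^sup>2 + a\<^sup>2 = 1" "y * b + z * c + x * a = 0"
      "\<rho> \<le> 9/22 \<Longrightarrow> (width_norm b c a)\<^sup>2 * (1 + 2 * \<rho>\<^sup>2) \<le> 4 * (1 + \<rho>)\<^sup>2"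
      "(width_norm b c a)\<^sup>2 \<le> 961/150" by metis
    have "width_norm a b c = width_norm b c a" using width_norm_perm by metis
    then show ?thesis using that[of a b c] n by (simp add: add.commute add.left_commute)
  next
    case 3
    have "x\<^sup>2 + z\<^sup>2 + y\<^sup>2 = 1" using unit by simp
    from probe_direction[OF 3 this \<rho>] obtain a c b where n: "a\<^sup>2 + c\<^sup>2 + b\<^sup>2 = 1" "x * a + z * c + y * b = 0"
      "\<rho> \<le> 9/22 \<Longrightarrow> (width_norm a c b)\<^sup>2 * (1 + 2 * \<rho>\<^sup>2) \<le> 4 * (1 + \<rho>)\<^sup>2"
      "(width_norm a c b)\<^sup>2 \<le> 961/150" by metis
    have "width_norm a b c = width_norm a c b" using width_norm_perm by metis
    then show ?thesis using that[of a b c] n by (simp add: add.commute add.left_commute)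
  qed
qed

lemma view_direction_unit: "(cos \<theta> * sin \<phi>)\<^sup>2 + (sin \<theta> * sin \<phi>)\<^sup>2 + (cos \<phi>)\<^sup>2 = (1 :: real)"
proof -
  have "(cos \<theta> * sin \<phi>)\<^sup>2 + (sin \<theta> * sin \<phi>)\<^sup>2 = (sin \<phi>)\<^sup>2"
    by (simp add: power_mult_distrib flip: distrib_right)
  then show ?thesis by simp
qed

lemma dominated_if_narrower:
  assumes "view_width \<theta> \<phi> t < w" "w\<^sup>2 * (1 + 2 * \<rho>\<^sup>2) \<le> 4 * (1 + \<rho>)\<^sup>2" "0 \<le> \<rho>" "\<rho> \<le> 9/22"
  shows "dominated \<rho> (view_vec \<theta> \<phi> t 0) (view_vec \<theta> \<phi> t 1) (view_vec \<theta> \<phi> t 2)"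
proof (rule ccontr)
  assume "\<not> ?thesis"
  from not_dominated_width_bound[OF assms(3,4) this]
  have "4 * (1 + \<rho>)\<^sup>2 \<le> (view_width \<theta> \<phi> t)\<^sup>2 * (1 + 2 * \<rho>\<^sup>2)"
    unfolding view_vec_norm view_width_def by simp
  also have "\<dots> < w\<^sup>2 * (1 + 2 * \<rho>\<^sup>2)"
    using assms(1) view_width_pos[of \<theta> \<phi> t]
    by (intro mult_strict_right_mono power_strict_mono) (auto simp: add_pos_nonneg)
  finally show False using assms(2) by simp
qed

lemma dominated_if_narrower_last:
  assumes "view_width \<theta> \<phi> t < w" "w\<^sup>2 \<le> 961/150" "14/25 \<le> \<rho>"
  shows "dominated \<rho> (view_vec \<theta> \<phi> t 0) (view_vec \<theta> \<phi> t 1) (view_vec \<theta> \<phi> t 2)"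
proof (rule ccontr)
  assume "\<not> ?thesis"
  from not_dominated_width_bound_last[OF assms(3) this]
  have "961/150 \<le> (view_width \<theta> \<phi> t)\<^sup>2"
    unfolding view_vec_norm view_width_def by simp
  also have "\<dots> < w\<^sup>2"
    using assms(1) view_width_pos[of \<theta> \<phi> t] by (intro power_strict_mono) auto
  finally show False using assms(2) by simp
qed

text \<open>22 is the largest whole degree whose tangent (about 0.404) stays below 9/22 (about
  0.409).\<close>

lemma tan_deg_le: "k \<le> 22 \<Longrightarrow> 0 \<le> tan (deg k) \<and> tan (deg k) \<le> 9/22"
proof
  assume k: "k \<le> 22"
  have d: "0 \<le> deg k" "deg k \<le> deg 22" "deg 22 < pi/2"
    using k by (auto simp: deg_simps(3)) (simp add: deg_def)
  then have "deg k < pi/2" by linarith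
  then show "0 \<le> tan (deg k)" using d(1) by (cases "deg k = 0") (auto intro!: less_imp_le tan_gt_zero)
  have "sn 22 = 37461" "sn 68 = 92718" by code_simp+
  then have s: "100000 * sin (deg 22) \<le> 37462" "92717 \<le> 100000 * cos (deg 22)"
    using sn_bounds(2)[of 22] sn_bounds(1)[of 68] by (simp_all add: cos_deg_eq)
  have "tan (deg k) \<le> tan (deg 22)"
    using d pi_gt_zero by (intro tan_mono_le) linarith+
  also have "\<dots> \<le> 9/22" using s by (simp add: tan_def field_simps)
  finally show "tan (deg k) \<le> 9/22" .
qed

text \<open>The direction \<beta> is fixed by the second pose before the first pose enters. Hence a
  single \<beta> serves the whole integral over \<alpha>, \<theta> and \<phi>.\<close>

lemma probe_noncentral:
  assumes "(\<theta>', \<phi>') \<in> {0..pi/2} \<times> {0..2*pi}" "(\<theta>', \<phi>') \<notin> central_views (deg k)" "k \<le> 22"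
  obtains \<beta> where "\<beta> \<in> {0..2*pi}" "\<forall>\<theta> \<phi> t. view_width \<theta> \<phi> t < view_width \<theta>' \<phi>' \<beta> \<longrightarrow>
    dominated (tan (deg k)) (view_vec \<theta> \<phi> t 0) (view_vec \<theta> \<phi> t 1) (view_vec \<theta> \<phi> t 2)"
proof -
  have \<rho>: "0 \<le> tan (deg k)" "tan (deg k) \<le> 9/22" using tan_deg_le[OF assms(3)] by auto
  have "\<not> (tan (deg k) * (\<bar>cos \<theta>' * sin \<phi>'\<bar> + \<bar>sin \<theta>' * sin \<phi>'\<bar>) \<le> \<bar>cos \<phi>'\<bar> \<and>
     tan (deg k) * (\<bar>sin \<theta>' * sin \<phi>'\<bar> + \<bar>cos \<phi>'\<bar>) \<le> \<bar>cos \<theta>' * sin \<phi>'\<bar> \<and>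
     tan (deg k) * (\<bar>cos \<theta>' * sin \<phi>'\<bar> + \<bar>cos \<phi>'\<bar>) \<le> \<bar>sin \<theta>' * sin \<phi>'\<bar>)"
    using assms(1,2) unfolding central_views_def by blast
  then have cond: "\<bar>cos \<phi>'\<bar> \<le> tan (deg k) * (\<bar>cos \<theta>' * sin \<phi>'\<bar> + \<bar>sin \<theta>' * sin \<phi>'\<bar>) \<or>
     \<bar>cos \<theta>' * sin \<phi>'\<bar> \<le> tan (deg k) * (\<bar>sin \<theta>' * sin \<phi>'\<bar> + \<bar>cos \<phi>'\<bar>) \<or>
     \<bar>sin \<theta>' * sin \<phi>'\<bar> \<le> tan (deg k) * (\<bar>cos \<theta>' * sin \<phi>'\<bar> + \<bar>cos \<phi>'\<bar>)"
    by linarith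
  have half: "tan (deg k) \<le> 1/2" using \<rho>(2) by simp
  obtain a b c where n: "a\<^sup>2 + b\<^sup>2 + c\<^sup>2 = 1" "cos \<theta>' * sin \<phi>' * a + sin \<theta>' * sin \<phi>' * b + cos \<phi>' * c = 0"
    "(width_norm a b c)\<^sup>2 * (1 + 2 * (tan (deg k))\<^sup>2) \<le> 4 * (1 + tan (deg k))\<^sup>2"
    by (rule probe_direction_perm[OF cond view_direction_unit \<rho>(1) half]) (use \<rho>(2) in blast)
  obtain \<beta> where \<beta>: "\<beta> \<in> {0..2*pi}" "view_vec \<theta>' \<phi>' \<beta> 0 = a" "view_vec \<theta>' \<phi>' \<beta> 1 = b" "view_vec \<theta>' \<phi>' \<beta> 2 = c"
    by (rule view_vec_surj[OF n(1,2)])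
  then have "view_width \<theta>' \<phi>' \<beta> = width_norm a b c" by (simp only: view_width_def)
  then show ?thesis using that[OF \<beta>(1)] dominated_if_narrower[OF _ n(3) \<rho>] by simp
qed

lemma probe_any:
  obtains \<beta> where "\<beta> \<in> {0..2*pi}" "\<forall>\<theta> \<phi> t. view_width \<theta> \<phi> t < view_width \<theta>' \<phi>' \<beta> \<longrightarrow>
    dominated (tan (deg 30)) (view_vec \<theta> \<phi> t 0) (view_vec \<theta> \<phi> t 1) (view_vec \<theta> \<phi> t 2)"
proof -
  have "sqrt 3 \<le> 25/14" by (rule real_le_lsqrt) (simp_all add: power_divide)
  then have t: "14/25 \<le> tan (deg 30)" by (simp add: deg_def tan_30 field_simps)
  \<comment> \<open>The three strict opposites would add up to a contradiction; this is why
    \<open>q\<close> never exceeds 1/2.\<close>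
  have "\<bar>cos \<phi>'\<bar> \<le> 1/2 * (\<bar>cos \<theta>' * sin \<phi>'\<bar> + \<bar>sin \<theta>' * sin \<phi>'\<bar>) \<or>
     \<bar>cos \<theta>' * sin \<phi>'\<bar> \<le> 1/2 * (\<bar>sin \<theta>' * sin \<phi>'\<bar> + \<bar>cos \<phi>'\<bar>) \<or>
     \<bar>sin \<theta>' * sin \<phi>'\<bar> \<le> 1/2 * (\<bar>cos \<theta>' * sin \<phi>'\<bar> + \<bar>cos \<phi>'\<bar>)"
    by argo
  from probe_direction_perm[OF this view_direction_unit]
  obtain a b c where n: "a\<^sup>2 + b\<^sup>2 + c\<^sup>2 = 1" "cos \<theta>' * sin \<phi>' * a + sin \<theta>' * sin \<phi>' * b + cos \<phi>' * c = 0"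
    "(width_norm a b c)\<^sup>2 \<le> 961/150" by auto
  obtain \<beta> where \<beta>: "\<beta> \<in> {0..2*pi}" "view_vec \<theta>' \<phi>' \<beta> 0 = a" "view_vec \<theta>' \<phi>' \<beta> 1 = b" "view_vec \<theta>' \<phi>' \<beta> 2 = c"
    by (rule view_vec_surj[OF n(1,2)])
  then have "view_width \<theta>' \<phi>' \<beta> = width_norm a b c" by (simp only: view_width_def)
  then show ?thesis using that[OF \<beta>(1)] dominated_if_narrower_last[OF _ n(3) t] by simp
qed

text \<open>Quantifying over all directions \<open>t\<close>, instead of choosing one by a formula, makes this set the
  projection of a compact set and hence Borel.\<close>

definition certified :: "(real \<times> real \<times> real \<times> real \<times> real) set" where
  "certified = {(\<alpha>, \<theta>, \<phi>, \<theta>', \<phi>'). (\<alpha>, \<theta>, \<phi>, \<theta>', \<phi>') \<in> Lambda \<and>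
     (\<exists>t\<in>{0..2*pi}. view_width \<theta>' \<phi>' t \<le> view_width \<theta> \<phi> (t - \<alpha>))}"

lemma continuous_on_view_vec:
  fixes f g h :: "'a::t2_space \<Rightarrow> real"
  assumes "continuous_on S f" "continuous_on S g" "continuous_on S h"
  shows "continuous_on S (\<lambda>x. view_vec (f x) (g x) (h x) i)"
proof -
  note rules = continuous_on_diff continuous_on_mult continuous_on_minus continuous_on_sin continuous_on_cos
  consider "i = 0" | "i = 1" | "i \<noteq> 0" "i \<noteq> 1" by blast
  then show ?thesis
    by cases (simp_all add: view_vec_def rules assms)
qed

lemma continuous_on_view_width [continuous_intros]:
  fixes f g h :: "'a::t2_space \<Rightarrow> real"
  assumes "continuous_on S f" "continuous_on S g" "continuous_on S h"
  shows "continuous_on S (\<lambda>x. view_width (f x) (g x) (h x))"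
  unfolding view_width_def width_norm_def
  by (intro continuous_on_max continuous_on_mult continuous_on_add continuous_on_rabs
      continuous_on_const continuous_on_view_vec assms)

lemma compact_Lambda: "compact Lambda"
  unfolding Lambda_def by (intro compact_Times compact_Icc)

lemma certified_borel: "certified \<in> sets borel"
proof -
  let ?W = "\<lambda>p. view_width (fst (snd (snd (snd (fst p))))) (snd (snd (snd (snd (fst p))))) (snd p :: real)"
  let ?V = "\<lambda>p. view_width (fst (snd (fst p))) (fst (snd (snd (fst p)))) (snd p - fst (fst p))"
  let ?K = "(Lambda \<times> {0..2*pi}) \<inter> {p. ?W p \<le> ?V p}"
  have "closed {p. ?W p \<le> ?V p}"
    by (intro closed_Collect_le continuous_intros)
  then have "compact ?K"
    by (intro compact_Int_closed compact_Times compact_Lambda compact_Icc)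
  then have "compact (fst ` ?K)"
    by (intro compact_continuous_image continuous_intros)
  moreover have "certified = fst ` ?K"
    by (force simp: certified_def)
  ultimately show ?thesis by (simp add: compact_imp_closed)
qed

text \<open>Right-nested products put \<alpha> outermost, while the estimate needs (\<alpha>,
  \<theta>) innermost and the second pose outermost. This moves the first two coordinates to the
  inside; the second part supplies the measurability for exchanging the rest.\<close>

lemma emeasure_lborel_triple:
  fixes A :: "('a::euclidean_space \<times> 'b::euclidean_space \<times> 'c::euclidean_space) set"
  assumes [measurable]: "A \<in> sets borel"
  shows "emeasure lborel A = (\<integral>\<^sup>+c. emeasure lborel {(a, b). (a, b, c) \<in> A} \<partial>lborel)"
    and "(\<lambda>c. emeasure lborel {(a, b). (a, b, c) \<in> A}) \<in> borel_measurable borel"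
proof -
  define f :: "'a \<times> 'b \<times> 'c \<Rightarrow> ennreal" where "f = indicator A"
  have A: "A \<in> sets (borel \<Otimes>\<^sub>M (borel \<Otimes>\<^sub>M borel))" using assms unfolding borel_prod .
  have f [measurable]: "f \<in> borel_measurable (lborel \<Otimes>\<^sub>M (lborel \<Otimes>\<^sub>M lborel))"
    using A unfolding f_def by (simp add: borel_prod lborel_prod)
  have sec: "(\<integral>\<^sup>+a. \<integral>\<^sup>+b. f (a, b, c) \<partial>lborel \<partial>lborel) = emeasure lborel {(a, b). (a, b, c) \<in> A}" for c
  proof -
    have m: "(\<lambda>p. f (fst p, snd p, c)) \<in> borel_measurable (lborel \<Otimes>\<^sub>M lborel)" by measurable
    have "(\<integral>\<^sup>+a. \<integral>\<^sup>+b. f (a, b, c) \<partial>lborel \<partial>lborel) = (\<integral>\<^sup>+p. f (fst p, snd p, c) \<partial>(lborel \<Otimes>\<^sub>M lborel))"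
      using lborel.nn_integral_fst[OF m] by simp
    also have "\<dots> = (\<integral>\<^sup>+p. indicator {(a, b). (a, b, c) \<in> A} p \<partial>(lborel :: ('a \<times> 'b) measure))"
      unfolding lborel_prod by (intro nn_integral_cong) (auto simp: f_def indicator_def split_beta)
    also have "\<dots> = emeasure lborel {(a, b). (a, b, c) \<in> A}"
    proof (rule nn_integral_indicator)
      have "(\<lambda>p :: 'a \<times> 'b. (fst p, snd p, c)) -` A \<inter> space borel \<in> sets borel"
        by (rule measurable_sets[OF borel_measurable_continuous_onI assms]) (intro continuous_intros)
      also have "(\<lambda>p :: 'a \<times> 'b. (fst p, snd p, c)) -` A \<inter> space borel = {(a, b). (a, b, c) \<in> A}" by auto
      finally show "{(a, b). (a, b, c) \<in> A} \<in> sets lborel" by simp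
    qed
    finally show ?thesis .
  qed
  have "emeasure lborel A = (\<integral>\<^sup>+p. f p \<partial>(lborel \<Otimes>\<^sub>M (lborel \<Otimes>\<^sub>M lborel)))"
    unfolding lborel_prod f_def by simp
  also have "\<dots> = (\<integral>\<^sup>+a. \<integral>\<^sup>+p. f (a, p) \<partial>(lborel \<Otimes>\<^sub>M lborel) \<partial>lborel)"
    unfolding lborel_prod using f unfolding lborel_prod
    by (subst (1) lborel.nn_integral_fst[symmetric, where ?M1.0 = lborel, unfolded lborel_prod]) auto
  also have "\<dots> = (\<integral>\<^sup>+a. \<integral>\<^sup>+c. \<integral>\<^sup>+b. f (a, b, c) \<partial>lborel \<partial>lborel \<partial>lborel)"
    by (intro nn_integral_cong lborel_pair.nn_integral_snd[symmetric]) measurable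
  also have "\<dots> = (\<integral>\<^sup>+c. \<integral>\<^sup>+a. \<integral>\<^sup>+b. f (a, b, c) \<partial>lborel \<partial>lborel \<partial>lborel)"
    by (rule lborel_pair.Fubini') measurable
  finally show "emeasure lborel A = (\<integral>\<^sup>+c. emeasure lborel {(a, b). (a, b, c) \<in> A} \<partial>lborel)"
    unfolding sec .
  have "(\<lambda>c. \<integral>\<^sup>+a. \<integral>\<^sup>+b. f (a, b, c) \<partial>lborel \<partial>lborel) \<in> borel_measurable borel"
    by measurable
  then show "(\<lambda>c. emeasure lborel {(a, b). (a, b, c) \<in> A}) \<in> borel_measurable borel"
    unfolding sec .
qed

section \<open>The volume of the uncertified set\<close>

definition uncertified :: "(real \<times> real \<times> real \<times> real \<times> real) set" where
  "uncertified = Lambda - certified"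

lemma uncertified_borel: "uncertified \<in> sets borel"
  unfolding uncertified_def using compact_Lambda certified_borel by (simp add: compact_imp_closed)

definition uncertified_slice :: "real \<Rightarrow> real \<times> real \<Rightarrow> ennreal" where
  "uncertified_slice \<phi> Y = emeasure lborel {(\<alpha>, \<theta>). (\<alpha>, \<theta>, \<phi>, Y) \<in> uncertified}"

text \<open>An uncertified point fails the width test in every direction, in particular in the probe
  direction \<beta>.\<close>

lemma uncertified_slice_le:
  assumes "\<beta> \<in> {0..2*pi}" "\<forall>\<theta> \<phi> t. view_width \<theta> \<phi> t < view_width \<theta>' \<phi>' \<beta> \<longrightarrow>
    dominated (tan k) (view_vec \<theta> \<phi> t 0) (view_vec \<theta> \<phi> t 1) (view_vec \<theta> \<phi> t 2)"
  shows "uncertified_slice \<phi> (\<theta>', \<phi>') \<le> emeasure lborel (rel_dominated k \<phi> \<beta>) * indicator {0..pi} \<phi>"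
proof (cases "\<phi> \<in> {0..pi}")
  case True
  have "{(\<alpha>, \<theta>). (\<alpha>, \<theta>, \<phi>, \<theta>', \<phi>') \<in> uncertified} \<subseteq> rel_dominated k \<phi> \<beta>"
  proof clarify
    fix \<alpha> \<theta> assume u: "(\<alpha>, \<theta>, \<phi>, \<theta>', \<phi>') \<in> uncertified"
    then have "view_width \<theta> \<phi> (\<beta> - \<alpha>) < view_width \<theta>' \<phi>' \<beta>"
      using assms(1) by (auto simp: uncertified_def certified_def not_le)
    then show "(\<alpha>, \<theta>) \<in> rel_dominated k \<phi> \<beta>"
      using assms(2) u by (auto simp: rel_dominated_def uncertified_def Lambda_def)
  qed
  then have "uncertified_slice \<phi> (\<theta>', \<phi>') \<le> emeasure lborel (rel_dominated k \<phi> \<beta>)"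
    unfolding uncertified_slice_def by (rule emeasure_mono) simp
  then show ?thesis using True by simp
next
  case False
  then have "{(\<alpha>, \<theta>). (\<alpha>, \<theta>, \<phi>, \<theta>', \<phi>') \<in> uncertified} = {}"
    by (auto simp: uncertified_def Lambda_def)
  then show ?thesis by (simp add: uncertified_slice_def)
qed

definition views :: "(real \<times> real) set" where "views = {0..pi/2} \<times> {0..2*pi}"

lemma slice_integral_noncentral:
  assumes "Y \<in> views" "Y \<notin> central_views (deg k)" "k \<le> 22"
    and bound: "\<And>\<beta>. (\<integral>\<^sup>+\<phi>. emeasure lborel (rel_dominated (deg k) \<phi> \<beta>) * indicator {0..pi} \<phi> \<partial>lborel) \<le> B"
  shows "(\<integral>\<^sup>+\<phi>. uncertified_slice \<phi> Y \<partial>lborel) \<le> B"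
proof -
  obtain \<theta>' \<phi>' where Y: "Y = (\<theta>', \<phi>')" by fastforce
  obtain \<beta> where "\<beta> \<in> {0..2*pi}" "\<forall>\<theta> \<phi> t. view_width \<theta> \<phi> t < view_width \<theta>' \<phi>' \<beta> \<longrightarrow>
    dominated (tan (deg k)) (view_vec \<theta> \<phi> t 0) (view_vec \<theta> \<phi> t 1) (view_vec \<theta> \<phi> t 2)"
    by (rule probe_noncentral[OF assms(1,2,3)[unfolded Y views_def]])
  from uncertified_slice_le[OF this]
  have "(\<integral>\<^sup>+\<phi>. uncertified_slice \<phi> Y \<partial>lborel) \<le>
      (\<integral>\<^sup>+\<phi>. emeasure lborel (rel_dominated (deg k) \<phi> \<beta>) * indicator {0..pi} \<phi> \<partial>lborel)"
    unfolding Y by (intro nn_integral_mono)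
  also have "\<dots> \<le> B" by (rule bound)
  finally show ?thesis .
qed

lemma slice_integral_any:
  assumes bound: "\<And>\<beta>. (\<integral>\<^sup>+\<phi>. emeasure lborel (rel_dominated (deg 30) \<phi> \<beta>) * indicator {0..pi} \<phi> \<partial>lborel) \<le> B"
  shows "(\<integral>\<^sup>+\<phi>. uncertified_slice \<phi> Y \<partial>lborel) \<le> B"
proof -
  obtain \<theta>' \<phi>' where Y: "Y = (\<theta>', \<phi>')" by fastforce
  obtain \<beta> where "\<beta> \<in> {0..2*pi}" "\<forall>\<theta> \<phi> t. view_width \<theta> \<phi> t < view_width \<theta>' \<phi>' \<beta> \<longrightarrow>
    dominated (tan (deg 30)) (view_vec \<theta> \<phi> t 0) (view_vec \<theta> \<phi> t 1) (view_vec \<theta> \<phi> t 2)"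
    by (rule probe_any[where \<theta>' = \<theta>' and \<phi>' = \<phi>'])
  from uncertified_slice_le[OF this]
  have "(\<integral>\<^sup>+\<phi>. uncertified_slice \<phi> Y \<partial>lborel) \<le>
      (\<integral>\<^sup>+\<phi>. emeasure lborel (rel_dominated (deg 30) \<phi> \<beta>) * indicator {0..pi} \<phi> \<partial>lborel)"
    unfolding Y by (intro nn_integral_mono)
  also have "\<dots> \<le> B" by (rule bound)
  finally show ?thesis .
qed

lemma slice_integral_outside:
  assumes "Y \<notin> views"
  shows "(\<integral>\<^sup>+\<phi>. uncertified_slice \<phi> Y \<partial>lborel) = 0"
proof -
  have "{(\<alpha>, \<theta>). (\<alpha>, \<theta>, \<phi>, Y) \<in> uncertified} = {}" for \<phi>
    using assms by (auto simp: uncertified_def Lambda_def views_def)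
  then show ?thesis by (simp add: uncertified_slice_def)
qed

lemma emeasure_uncertified_eq:
  "emeasure lborel uncertified = (\<integral>\<^sup>+Y. \<integral>\<^sup>+\<phi>. uncertified_slice \<phi> Y \<partial>lborel \<partial>lborel)"
proof -
  have m: "(\<lambda>p. uncertified_slice (fst p) (snd p)) \<in> borel_measurable (lborel \<Otimes>\<^sub>M lborel)"
    using emeasure_lborel_triple(2)[OF uncertified_borel]
    unfolding lborel_prod uncertified_slice_def by simp
  have "emeasure lborel uncertified = (\<integral>\<^sup>+p. uncertified_slice (fst p) (snd p) \<partial>(lborel \<Otimes>\<^sub>M lborel))"
    using emeasure_lborel_triple(1)[OF uncertified_borel]
    unfolding lborel_prod uncertified_slice_def by simp
  also have "\<dots> = (\<integral>\<^sup>+Y. \<integral>\<^sup>+\<phi>. uncertified_slice \<phi> Y \<partial>lborel \<partial>lborel)"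
    using lborel_pair.nn_integral_snd[OF m] by simp
  finally show ?thesis .
qed

lemma emeasure_uncertified: "emeasure lborel uncertified \<le> ennreal (12/100 * pi ^ 5)"
proof -
  define d where "d = pi / 180"
  have d: "0 \<le> d" by (simp add: d_def)
  let ?c = "\<lambda>k Y. indicator (central_views (deg k)) Y :: real"
  \<comment> \<open>The coefficients are the successive differences of the totals for 4, 8, 11, 14,
    18, 22 and 30 degrees. If Y lies in the regions of all smaller angles, the partial sum is the
    total for the next one, and the other summands are nonnegative.\<close>
  define b where "b Y = 102832 * indicator views Y + 245072 * ?c 4 Y + 260080 * ?c 8 Y + 320400 * ?c 11 Y
    + 504128 * ?c 14 Y + 585568 * ?c 18 Y + 1384400 * ?c 22 Y" for Y
  have [measurable]: "views \<in> sets borel"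
    by (auto simp: views_def intro!: borel_closed closed_Times)
  have point: "(\<integral>\<^sup>+\<phi>. uncertified_slice \<phi> Y \<partial>lborel) \<le> ennreal (b Y * d ^ 3)" for Y
  proof (cases "Y \<in> views")
    case False
    then show ?thesis by (simp add: slice_integral_outside)
  next
    case V: True
    have step: "(\<integral>\<^sup>+\<phi>. uncertified_slice \<phi> Y \<partial>lborel) \<le> ennreal (b Y * d ^ 3)"
      if "(\<integral>\<^sup>+\<phi>. uncertified_slice \<phi> Y \<partial>lborel) \<le> ennreal (n * (pi / 180) ^ 3)" "n \<le> b Y" for n
      using that d by (elim order_trans) (auto simp: d_def intro!: ennreal_leI mult_right_mono)
    note nc = slice_integral_noncentral[OF V]
    \<comment> \<open>Split according to the first listed angle whose central region misses
      Y.\<close>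
    consider "Y \<notin> central_views (deg 4)"
      | "Y \<in> central_views (deg 4)" "Y \<notin> central_views (deg 8)"
      | "Y \<in> central_views (deg 4)" "Y \<in> central_views (deg 8)" "Y \<notin> central_views (deg 11)"
      | "Y \<in> central_views (deg 4)" "Y \<in> central_views (deg 8)" "Y \<in> central_views (deg 11)"
        "Y \<notin> central_views (deg 14)"
      | "Y \<in> central_views (deg 4)" "Y \<in> central_views (deg 8)" "Y \<in> central_views (deg 11)"
        "Y \<in> central_views (deg 14)" "Y \<notin> central_views (deg 18)"
      | "Y \<in> central_views (deg 4)" "Y \<in> central_views (deg 8)" "Y \<in> central_views (deg 11)"
        "Y \<in> central_views (deg 14)" "Y \<in> central_views (deg 18)" "Y \<notin> central_views (deg 22)"
      | "Y \<in> central_views (deg 4)" "Y \<in> central_views (deg 8)" "Y \<in> central_views (deg 11)"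
        "Y \<in> central_views (deg 14)" "Y \<in> central_views (deg 18)" "Y \<in> central_views (deg 22)"
      by blast
    then show ?thesis
    proof cases
      case 1
      show ?thesis by (rule step[OF nc[OF 1 _ dominated_4]]) (use V 1 in \<open>simp_all add: b_def\<close>)
    next
      case 2
      show ?thesis by (rule step[OF nc[OF 2(2) _ dominated_8]]) (use V 2 in \<open>simp_all add: b_def\<close>)
    next
      case 3
      show ?thesis by (rule step[OF nc[OF 3(3) _ dominated_11]]) (use V 3 in \<open>simp_all add: b_def\<close>)
    next
      case 4
      show ?thesis by (rule step[OF nc[OF 4(4) _ dominated_14]]) (use V 4 in \<open>simp_all add: b_def\<close>)
    next
      case 5
      show ?thesis by (rule step[OF nc[OF 5(5) _ dominated_18]]) (use V 5 in \<open>simp_all add: b_def\<close>)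
    next
      case 6
      show ?thesis by (rule step[OF nc[OF 6(6) _ dominated_22]]) (use V 6 in \<open>simp_all add: b_def\<close>)
    next
      case 7
      show ?thesis by (rule step[OF slice_integral_any[OF dominated_30]]) (use V 7 in \<open>simp_all add: b_def\<close>)
    qed
  qed
  have split: "ennreal (b Y * d ^ 3) = ennreal (102832 * d ^ 3) * indicator views Y
    + ennreal (245072 * d ^ 3) * indicator (central_views (deg 4)) Y
    + ennreal (260080 * d ^ 3) * indicator (central_views (deg 8)) Y
    + ennreal (320400 * d ^ 3) * indicator (central_views (deg 11)) Y
    + ennreal (504128 * d ^ 3) * indicator (central_views (deg 14)) Y
    + ennreal (585568 * d ^ 3) * indicator (central_views (deg 18)) Y
    + ennreal (1384400 * d ^ 3) * indicator (central_views (deg 22)) Y" for Y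
    using d unfolding ennreal_indicator[symmetric]
    by (simp add: b_def distrib_right mult.assoc mult.commute[of _ "indicator _ _"] flip: ennreal_plus ennreal_mult)
  have V: "emeasure lborel views = ennreal (32400 * d ^ 2)"
  proof -
    have "emeasure lborel views = emeasure lborel {0..pi/2} * emeasure lborel {0..2*pi}"
      unfolding views_def lborel_prod[symmetric] by (rule lborel.emeasure_pair_measure_Times) auto
    also have "\<dots> = ennreal (pi/2) * ennreal (2*pi)" by simp
    also have "\<dots> = ennreal (pi/2 * (2*pi))" by (rule ennreal_mult[symmetric]) simp_all
    also have "pi/2 * (2*pi) = 32400 * d ^ 2" by (simp add: d_def power2_eq_square)
    finally show ?thesis .
  qed
  have C: "emeasure lborel (central_views (deg 4)) \<le> ennreal (22288 * d ^ 2)"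
    "emeasure lborel (central_views (deg 8)) \<le> ennreal (14752 * d ^ 2)"
    "emeasure lborel (central_views (deg 11)) \<le> ennreal (10272 * d ^ 2)"
    "emeasure lborel (central_views (deg 14)) \<le> ennreal (6648 * d ^ 2)"
    "emeasure lborel (central_views (deg 18)) \<le> ennreal (3120 * d ^ 2)"
    "emeasure lborel (central_views (deg 22)) \<le> ennreal (936 * d ^ 2)"
    using central_4 central_8 central_11 central_14 central_18 central_22 by (simp_all add: d_def)
  have "emeasure lborel uncertified \<le> (\<integral>\<^sup>+Y. ennreal (b Y * d ^ 3) \<partial>lborel)"
    unfolding emeasure_uncertified_eq by (intro nn_integral_mono point)
  also have "\<dots> = ennreal (102832 * d ^ 3) * emeasure lborel views
    + ennreal (245072 * d ^ 3) * emeasure lborel (central_views (deg 4))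
    + ennreal (260080 * d ^ 3) * emeasure lborel (central_views (deg 8))
    + ennreal (320400 * d ^ 3) * emeasure lborel (central_views (deg 11))
    + ennreal (504128 * d ^ 3) * emeasure lborel (central_views (deg 14))
    + ennreal (585568 * d ^ 3) * emeasure lborel (central_views (deg 18))
    + ennreal (1384400 * d ^ 3) * emeasure lborel (central_views (deg 22))"
    unfolding split by (simp add: nn_integral_add nn_integral_cmult_indicator)
  also have "\<dots> \<le> ennreal (102832 * d ^ 3) * ennreal (32400 * d ^ 2)
    + ennreal (245072 * d ^ 3) * ennreal (22288 * d ^ 2)
    + ennreal (260080 * d ^ 3) * ennreal (14752 * d ^ 2)
    + ennreal (320400 * d ^ 3) * ennreal (10272 * d ^ 2)
    + ennreal (504128 * d ^ 3) * ennreal (6648 * d ^ 2)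
    + ennreal (585568 * d ^ 3) * ennreal (3120 * d ^ 2)
    + ennreal (1384400 * d ^ 3) * ennreal (936 * d ^ 2)"
    unfolding V by (intro add_mono mult_left_mono C order_refl) simp_all
  also have "\<dots> = ennreal (22395984000 * d ^ 5)"
  proof -
    have m: "ennreal (x * d ^ 3) * ennreal (y * d ^ 2) = ennreal (x * y * d ^ 5)" if "0 \<le> x" "0 \<le> y" for x y
    proof -
      have "x * d ^ 3 * (y * d ^ 2) = x * y * d ^ 5" by (simp add: eval_nat_numeral)
      then show ?thesis using that d by (simp flip: ennreal_mult)
    qed
    have p: "ennreal (x * d ^ 5) + ennreal (y * d ^ 5) = ennreal ((x + y) * d ^ 5)" if "0 \<le> x" "0 \<le> y" for x y
      using that d by (simp add: distrib_right ennreal_plus)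
    show ?thesis by (simp add: m p)
  qed
  \<comment> \<open>In cells of one degree \<open>Lambda\<close> has volume 180^5, and 12 percent of
    this is 22674816000.\<close>
  also have "\<dots> \<le> ennreal (12/100 * pi ^ 5)"
    by (rule ennreal_leI) (simp add: d_def power_divide)
  finally show ?thesis .
qed

lemma measure_Lambda: "emeasure lborel Lambda = ennreal (pi ^ 5)"
proof -
  have t: "emeasure lborel (A \<times> B) = emeasure lborel A * emeasure lborel B"
    if "A \<in> sets borel" "B \<in> sets borel" for A :: "'a::euclidean_space set" and B :: "'b::euclidean_space set"
    unfolding lborel_prod[symmetric] using that by (intro lborel.emeasure_pair_measure_Times) auto
  have "emeasure lborel Lambda = emeasure lborel {0..2*pi} * (emeasure lborel {0..pi/2} *
      (emeasure lborel {0..pi} * (emeasure lborel {0..pi/2} * emeasure lborel {0..2*pi})))"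
    unfolding Lambda_def by (subst t, (auto intro!: borel_closed closed_Times)[2])+ simp
  also have "\<dots> = ennreal (2*pi) * (ennreal (pi/2) * (ennreal pi * (ennreal (pi/2) * ennreal (2*pi))))"
    by simp
  also have "\<dots> = ennreal (2*pi * (pi/2 * (pi * (pi/2 * (2*pi)))))"
    by (simp only: ennreal_mult mult_nonneg_nonneg divide_nonneg_nonneg pi_ge_zero zero_le_numeral)
  also have "2*pi * (pi/2 * (pi * (pi/2 * (2*pi)))) = pi ^ 5" by (simp add: eval_nat_numeral)
  finally show ?thesis .
qed

theorem mainTheorem1:
  shows "\<exists>E. E \<in> sets lebesgue \<and> E \<subseteq> Lambda \<and>
           measure lebesgue E \<ge> (88/100) * measure lebesgue Lambda \<and>
           (\<forall>\<alpha> \<theta> \<phi> \<theta>' \<phi>'. (\<alpha>, \<theta>, \<phi>, \<theta>', \<phi>') \<in> E \<longrightarrow>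
              \<not> rupert_passage (polyP (11/20)) \<alpha> \<theta> \<phi> \<theta>' \<phi>')"
proof (intro exI[of _ certified] conjI)
  have L: "Lambda \<in> sets borel" using compact_Lambda by (simp add: compact_imp_closed)
  show "certified \<in> sets lebesgue" using certified_borel by simp
  show sub: "certified \<subseteq> Lambda" by (auto simp: certified_def)
  have mL: "measure lborel Lambda = pi ^ 5"
    unfolding measure_def measure_Lambda by simp
  have "measure lborel uncertified \<le> 12/100 * pi ^ 5"
    unfolding measure_def using emeasure_uncertified by (intro enn2real_leI) auto
  moreover have "measure lborel certified = measure lborel Lambda - measure lborel uncertified"
  proof -
    have "certified = Lambda - uncertified" using sub by (auto simp: uncertified_def)
    moreover have "Lambda \<in> fmeasurable lborel"
      by (rule fmeasurableI) (use L measure_Lambda in simp_all)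
    then have "measure lborel (Lambda - uncertified) = measure lborel Lambda - measure lborel uncertified"
      by (rule measurable_measure_Diff) (use uncertified_borel in \<open>auto simp: uncertified_def\<close>)
    ultimately show ?thesis by simp
  qed
  ultimately show "measure lebesgue certified \<ge> (88/100) * measure lebesgue Lambda"
    using L certified_borel mL by (simp add: measure_completion)
  show "\<forall>\<alpha> \<theta> \<phi> \<theta>' \<phi>'. (\<alpha>, \<theta>, \<phi>, \<theta>', \<phi>') \<in> certified \<longrightarrow>
      \<not> rupert_passage (polyP (11/20)) \<alpha> \<theta> \<phi> \<theta>' \<phi>'"
    using rupert_passage_view_width by (fastforce simp: certified_def not_le[symmetric])
qed

end
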